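(* Consider the scheme $$\overline{\mathbf U}_j^{n+1}=\overline{\mathbf U}_j^n-\frac{\Delta t_n}{\Delta x}\Big(\hat{\mathbf F}_1(\mathbf U_{j+\frac12}^-,\mathbf U_{j+\frac12}^+)-\hat{\mathbf F}_1(\mathbf U_{j-\frac12}^-,\mathbf U_{j-\frac12}^+)\Big),\qquad \hat{\mathbf F}_1(\mathbf U^-,\mathbf U^+)=\frac12\Big(\mathbf F_1(\mathbf U^-)+\mathbf F_1(\mathbf U^+)-(\mathbf U^+-\mathbf U^-)\Big),$$ where $\mathbf U_{j+\frac12}^-=\mathbf U_j^n(x_{j+\frac12})$ and $\mathbf U_{j+\frac12}^+=\mathbf U_{j+1}^n(x_{j+\frac12})$ are the limiting values of the polynomial vectors $\mathbf U_j^n(x)$ in the cells $I_j$. If the polynomial vectors $\mathbf U_j^n(x)=:(D_j(x),\mathbf m_j(x),\mathbf B_j(x),E_j(x))^\top$ satisfy (i) $B_{1,j}(x)=B_{\rm const}$ for any $x\in I_j$ and all $j$, and (ii) $\mathbf U_j^n(\hat x_j^\alpha)\in\mathcal G$ for all $j$ and $\alpha=1,2,\dots,L$, then under the CFL type condition $$0<\Delta t_n\le\hat\omega_1\Delta x$$ it holds that $\overline{\mathbf U}_j^{n+1}\in\mathcal G$ for all $j$.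
   Context: Fix the adiabatic index $\Gamma\in(1,2]$ (equation of state $p=(\Gamma-1)\rho e$; speed of light $c=1$). For primitive variables $\mathbf V=(\rho,\mathbf v,\mathbf B,p)$ with $\rho,p>0$, $\mathbf v,\mathbf B\in\mathbb R^3$, $|\mathbf v|<1$, put $W=(1-|\mathbf v|^2)^{-1/2}$, $e=\frac{p}{(\Gamma-1)\rho}$, $h=1+e+\frac p\rho$, $p_m=\frac12\big(W^{-2}|\mathbf B|^2+(\mathbf v\cdot\mathbf B)^2\big)$, $p_{tot}=p+p_m$. The associated conservative vector is $\mathbf U(\mathbf V)=(D,\mathbf m,\mathbf B,E)^\top\in\mathbb R^8$ with $D=\rho W$, $\mathbf m=\rho hW^2\mathbf v+|\mathbf B|^2\mathbf v-(\mathbf v\cdot\mathbf B)\mathbf B$, $E=\rho hW^2-p_{tot}+|\mathbf B|^2$. The admissible state set is $\mathcal G=\{\mathbf U(\mathbf V): \rho>0,\ p>0,\ |\mathbf v|<1,\ \mathbf B\in\mathbb R^3\}$. Each $\mathbf U\in\mathcal G$ determines its primitive variables, and for $\mathbf U\in\mathcal G$ the flux is $$\mathbf F_1(\mathbf U)=\Big(Dv_1,\ v_1\mathbf m-B_1\big(W^{-2}\mathbf B+(\mathbf v\cdot\mathbf B)\mathbf v\big)+p_{tot}\mathbf e_1,\ v_1\mathbf B-B_1\mathbf v,\ m_1\Big)^\top,\qquad\mathbf e_1=(1,0,0).$$ The mesh is uniform with step size $\Delta x>0$ and cells $I_j=(x_{j-\frac12},x_{j+\frac12})$, $j\in\mathbb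 Z$. For each $j$, $\mathbf U_j^n(x)$ is an $\mathbb R^8$-valued polynomial of degree at most $K$ ($K\ge1$) on $I_j$ whose average over $I_j$ is $\overline{\mathbf U}_j^n$. $\{\hat x_j^\alpha\}_{\alpha=1}^L$ are the $L$ Gauss–Lobatto nodes transformed to $I_j$ (in increasing order, so $\hat x_j^1=x_{j-\frac12}$, $\hat x_j^L=x_{j+\frac12}$), and $\{\hat\omega_\alpha\}_{\alpha=1}^L$ are the associated quadrature weights normalized by $\sum_\alpha\hat\omega_\alpha=1$; $L$ satisfies $2L-3\ge K$, so that the quadrature is exact for polynomials of degree at most $K$. $B_{1,j}$ is the first component of $\mathbf B_j$, and $B_{\rm const}$ is a constant independent of $j$ and $x$. *)

theory Defs
  imports "HOL-Analysis.Analysis" "HOL-Computational_Algebra.Polynomial"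
begin

text \<open>Primitive variables are tuples \<open>(\<rho>, v, B, p)\<close>, conservative ones \<open>(D, m, B, E)\<close>.\<close>

type_synonym prim = "real \<times> (real^3) \<times> (real^3) \<times> real"
type_synonym cons = "real \<times> (real^3) \<times> (real^3) \<times> real"

definition prim_states :: "prim set" where
  "prim_states = {(\<rho>, v, B, p). \<rho> > 0 \<and> p > 0 \<and> norm v < 1}"

definition lorentz :: "real^3 \<Rightarrow> real" where
  "lorentz v = 1 / sqrt (1 - (norm v)\<^sup>2)"

definition int_energy :: "real \<Rightarrow> real \<Rightarrow> real \<Rightarrow> real" where
  "int_energy \<Gamma> \<rho> p = p / ((\<Gamma> - 1) * \<rho>)"

definition enthalpy :: "real \<Rightarrow> real \<Rightarrow> real \<Rightarrow> real" where
  "enthalpy \<Gamma> \<rho> p = 1 + int_energy \<Gamma> \<rho> p + p / \<rho>"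

definition mag_pressure :: "real^3 \<Rightarrow> real^3 \<Rightarrow> real" where
  "mag_pressure v B = ((norm B)\<^sup>2 / (lorentz v)\<^sup>2 + (v \<bullet> B)\<^sup>2) / 2"

definition tot_pressure :: "real^3 \<Rightarrow> real^3 \<Rightarrow> real \<Rightarrow> real" where
  "tot_pressure v B p = p + mag_pressure v B"

definition cons_of_prim :: "real \<Rightarrow> prim \<Rightarrow> cons" where
  "cons_of_prim \<Gamma> = (\<lambda>(\<rho>, v, B, p).
     let W = lorentz v; h = enthalpy \<Gamma> \<rho> p in
     (\<rho> * W,
      (\<rho> * h * W\<^sup>2) *\<^sub>R v + (norm B)\<^sup>2 *\<^sub>R v - (v \<bullet> B) *\<^sub>R B,
      B,
      \<rho> * h * W\<^sup>2 - tot_pressure v B p + (norm B)\<^sup>2))"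

definition admissible :: "real \<Rightarrow> cons set" where
  "admissible \<Gamma> = cons_of_prim \<Gamma> ` prim_states"

text \<open>Only meaningful on \<open>admissible \<Gamma>\<close>, where the primitive variables are unique.\<close>

definition prim_of_cons :: "real \<Rightarrow> cons \<Rightarrow> prim" where
  "prim_of_cons \<Gamma> = inv_into prim_states (cons_of_prim \<Gamma>)"

definition flux1 :: "real \<Rightarrow> cons \<Rightarrow> cons" where
  "flux1 \<Gamma> U =
     (case U of (D, m, B, E) \<Rightarrow> case prim_of_cons \<Gamma> U of (\<rho>, v, _, p) \<Rightarrow>
      (D * v$1,
       v$1 *\<^sub>R m - B$1 *\<^sub>R ((1 / (lorentz v)\<^sup>2) *\<^sub>R B + (v \<bullet> B) *\<^sub>R v)
         + tot_pressure v B p *\<^sub>R axis 1 1,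
       v$1 *\<^sub>R B - B$1 *\<^sub>R v,
       m$1))"

definition num_flux1 :: "real \<Rightarrow> cons \<Rightarrow> cons \<Rightarrow> cons" where
  "num_flux1 \<Gamma> Um Up = (1/2) *\<^sub>R (flux1 \<Gamma> Um + flux1 \<Gamma> Up - (Up - Um))"

definition magnetic :: "cons \<Rightarrow> real^3" where
  "magnetic = (\<lambda>(D, m, B, E). B)"

definition vec_poly :: "nat \<Rightarrow> (real \<Rightarrow> 'a::real_vector) \<Rightarrow> bool" where
  "vec_poly K f \<longleftrightarrow> (\<exists>c. \<forall>x. f x = (\<Sum>k\<le>K. x ^ k *\<^sub>R c k))"

text \<open>Rodrigues' formula.\<close>

definition legendre :: "nat \<Rightarrow> real poly" where
  "legendre n = smult (1 / (2 ^ n * fact n)) ((pderiv ^^ n) ([:-1, 0, 1:] ^ n))"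

text \<open>The Gauss--Lobatto nodes on \<open>[-1, 1]\<close>, numbered from \<open>1\<close> to \<open>L\<close>: the end points and
  the zeros of the derivative of the Legendre polynomial of degree \<open>L - 1\<close>.\<close>

definition gauss_lobatto_nodes :: "nat \<Rightarrow> (nat \<Rightarrow> real) \<Rightarrow> bool" where
  "gauss_lobatto_nodes L \<xi> \<longleftrightarrow> L \<ge> 2 \<and> strict_mono_on {1..L} \<xi> \<and> \<xi> 1 = -1 \<and> \<xi> L = 1 \<and>
     \<xi> ` {1<..<L} = {x. poly (pderiv (legendre (L - 1))) x = 0}"

text \<open>Integrals of the Lagrange basis polynomials; the factor \<open>1/2\<close> makes the weights sum
  to \<open>1\<close>.\<close>

definition quad_weight :: "nat \<Rightarrow> (nat \<Rightarrow> real) \<Rightarrow> nat \<Rightarrow> real" where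
  "quad_weight L \<xi> \<alpha> =
     (1/2) * integral {-1..1} (\<lambda>x. \<Prod>\<beta>\<in>{1..L} - {\<alpha>}. (x - \<xi> \<beta>) / (\<xi> \<alpha> - \<xi> \<beta>))"

text \<open>A mesh is given by its cell interfaces, \<open>xh j\<close> standing for $x_{j+1/2}$.\<close>

definition cell :: "(int \<Rightarrow> real) \<Rightarrow> int \<Rightarrow> real set" where
  "cell xh j = {xh (j - 1)<..<xh j}"

definition cell_node :: "(int \<Rightarrow> real) \<Rightarrow> (nat \<Rightarrow> real) \<Rightarrow> int \<Rightarrow> nat \<Rightarrow> real" where
  "cell_node xh \<xi> j \<alpha> = (xh (j - 1) + xh j) / 2 + (xh j - xh (j - 1)) / 2 * \<xi> \<alpha>"

end

theory Submission
  imports Defs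
begin

text \<open>
  The admissible set is an intersection of open half-spaces: a state \<open>U = (D, m, B, E)\<close> is admissible
  iff \<open>D > 0\<close> and \<open>U \<bullet> dual_vec w C + mag_pressure w C > 0\<close> for all velocities \<open>|w| < 1\<close> and all
  fields \<open>C\<close> (lemmas \<open>admissible_imp_dual_pos\<close> and \<open>dual_pos_imp_admissible\<close>). Nonlinear
  constraints thereby become linear ones, and it remains to see that each of these affine
  functionals is positive on the updated average.

  By the exactness of the Gauss--Lobatto rule, the old average is a convex combination of the nodal
  values, whose two end weights are equal. Under the CFL condition these end weights leave room to
  write the updated average as a combination, with nonnegative coefficients of sum \<open>1\<close>, of nodal values
  and of the four terms \<open>V - F(V)\<close> (traces at the right interface) and \<open>V + F(V)\<close> (traces at the
  left interface), the latter with the same positive coefficient.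

  The heart of the matter is the splitting inequality \<open>lax_friedrichs_splitting_pos\<close> for
  \<open>V - \<kappa> F(V)\<close> with \<open>\<kappa> = 1\<close> or \<open>\<kappa> = -1\<close>. The half-space functional is positive there after the correction
  \<open>\<kappa> (w\<^sub>1 mag_pressure w C - B\<^sub>1 (w \<bullet> C))\<close> is subtracted. The corrections cancel between the two interfaces
  because \<open>B\<^sub>1\<close> is constant. The functional separates into a hydrodynamic part, which is positive
  by two elementary bounds on relative velocities and \<open>\<Gamma> \<le> 2\<close>, and a magnetic part, which is
  nonnegative: it is a quadratic polynomial in \<open>C\<close>, and completing the square leaves a Gram
  determinant.
\<close>

section \<open>Gauss--Lobatto quadrature\<close>

definition poly_integral :: "real poly \<Rightarrow> real" where
  "poly_integral p = integral {-1..1} (poly p)"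

lemma integrable_poly: "poly (p :: real poly) integrable_on {a..b}"
  by (intro integrable_continuous_interval continuous_intros)

lemma poly_integral_add: "poly_integral (p + q) = poly_integral p + poly_integral q"
  unfolding poly_integral_def poly_add by (rule integral_add[OF integrable_poly integrable_poly])

lemma poly_integral_smult: "poly_integral (smult c p) = c * poly_integral p"
  unfolding poly_integral_def poly_smult by (rule integral_mult_right)

lemma poly_integral_0 [simp]: "poly_integral 0 = 0"
  using poly_integral_smult[of 0 0] by simp

lemma poly_integral_sum: "poly_integral (sum f A) = (\<Sum>a\<in>A. poly_integral (f a))"
  by (induction A rule: infinite_finite_induct) (simp_all add: poly_integral_add)

lemma poly_integral_pderiv: "poly_integral (pderiv p) = poly p 1 - poly p (-1)"
  unfolding poly_integral_def
  by (intro integral_unique fundamental_theorem_of_calculus)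
     (auto simp flip: has_real_derivative_iff_has_vector_derivative intro: DERIV_subset[OF poly_DERIV])

lemma poly_integral_by_parts:
  assumes "poly f 1 = 0 \<or> poly g 1 = 0" "poly f (-1) = 0 \<or> poly g (-1) = 0"
  shows "poly_integral (pderiv f * g) = - poly_integral (f * pderiv g)"
proof -
  have "poly_integral (pderiv (f * g)) = 0" unfolding poly_integral_pderiv using assms by auto
  then show ?thesis by (simp add: pderiv_mult poly_integral_add mult.commute)
qed

lemma poly_integral_nonneg:
  assumes "\<And>x. -1 \<le> x \<Longrightarrow> x \<le> 1 \<Longrightarrow> poly p x \<ge> 0"
  shows "poly_integral p \<ge> 0"
  unfolding poly_integral_def by (rule integral_nonneg[OF integrable_poly]) (use assms in auto)

definition endpoint_poly :: "real poly" where "endpoint_poly = [:-1, 0, 1:]"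

lemma endpoint_poly_simps [simp]: "poly endpoint_poly x = x\<^sup>2 - 1" "degree endpoint_poly = 2" "endpoint_poly \<noteq> 0"
  by (simp_all add: endpoint_poly_def power2_eq_square)

text \<open>
  The factor \<open>x\<^sup>2 - 1\<close> loses one power with each derivative; what remains makes all boundary
  terms vanish when Rodrigues' formula is integrated by parts.
\<close>

lemma endpoint_poly_power_dvd_higher_pderiv:
  "k \<le> n \<Longrightarrow> endpoint_poly ^ (n - k) dvd (pderiv ^^ k) (endpoint_poly ^ n)"
proof (induction k)
  case (Suc k)
  then obtain r where r: "(pderiv ^^ k) (endpoint_poly ^ n) = endpoint_poly ^ (n - k) * r"
    by (auto elim: dvdE)
  define e where "e = n - Suc k"
  have e: "n - k = Suc e" using Suc.prems by (simp add: e_def)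
  have "(pderiv ^^ Suc k) (endpoint_poly ^ n) = pderiv (endpoint_poly ^ Suc e * r)"
    by (simp only: funpow.simps comp_apply r e)
  also have "\<dots> = endpoint_poly ^ e * (smult (of_nat (Suc e)) (pderiv endpoint_poly) * r + endpoint_poly * pderiv r)"
    by (simp only: pderiv_mult pderiv_power_Suc) (simp add: algebra_simps)
  finally show ?case by (simp only: e_def dvd_triv_left)
qed simp

lemma poly_integral_higher_pderiv_eq_0:
  "k \<le> n \<Longrightarrow> degree q < k \<Longrightarrow> poly_integral ((pderiv ^^ k) (endpoint_poly ^ n) * q) = 0"
proof (induction k arbitrary: q)
  case (Suc k)
  have "endpoint_poly dvd (pderiv ^^ k) (endpoint_poly ^ n)"
    using endpoint_poly_power_dvd_higher_pderiv[of k n] Suc.prems(1)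
    by (metis Suc_diff_le Suc_le_D dvd_mult_left diff_Suc_Suc power_Suc Suc_leD)
  then have "poly ((pderiv ^^ k) (endpoint_poly ^ n)) 1 = 0" "poly ((pderiv ^^ k) (endpoint_poly ^ n)) (-1) = 0"
    by (auto elim!: dvdE)
  then have "poly_integral ((pderiv ^^ Suc k) (endpoint_poly ^ n) * q) = - poly_integral ((pderiv ^^ k) (endpoint_poly ^ n) * pderiv q)"
    by (simp add: poly_integral_by_parts)
  also have "\<dots> = 0"
  proof (cases "degree q = 0")
    case True
    then have "pderiv q = 0" by (simp add: pderiv_eq_0_iff)
    then show ?thesis by simp
  next
    case False
    then show ?thesis using Suc by (simp add: degree_pderiv)
  qed
  finally show ?case .
qed simp

lemma legendre_orthogonal: "degree q < n \<Longrightarrow> poly_integral (legendre n * q) = 0"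
  by (simp add: legendre_def poly_integral_smult flip: endpoint_poly_def, simp add: poly_integral_higher_pderiv_eq_0)

lemma degree_legendre: "degree (legendre n) = n"
  by (simp add: legendre_def flip: endpoint_poly_def, simp add: degree_higher_pderiv degree_power_eq)

text \<open>
  Orthogonality of the node polynomial \<open>(x\<^sup>2 - 1) P'\<^sub>n\<close> of the Gauss--Lobatto rule: moving the
  derivative away from \<open>P\<^sub>n\<close> produces no boundary terms and leaves a factor of degree below \<open>n\<close>.
\<close>

lemma lobatto_orthogonal:
  assumes "degree q + 2 \<le> n"
  shows "poly_integral (endpoint_poly * pderiv (legendre n) * q) = 0"
proof -
  have "poly_integral (pderiv (legendre n) * (endpoint_poly * q)) = - poly_integral (legendre n * pderiv (endpoint_poly * q))"
    by (rule poly_integral_by_parts) auto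
  also have "degree (pderiv (endpoint_poly * q)) < n"
  proof -
    have "degree (endpoint_poly * q) \<le> 2 + degree q" using degree_mult_le[of endpoint_poly q] by simp
    then show ?thesis using assms by (simp add: degree_pderiv)
  qed
  then have "poly_integral (legendre n * pderiv (endpoint_poly * q)) = 0" by (rule legendre_orthogonal)
  finally show ?thesis by (simp add: ac_simps)
qed

lemma legendre_reflect: "pcompose (legendre n) [:0, -1:] = smult ((-1) ^ n) (legendre n)"
proof -
  have h: "pcompose ((pderiv ^^ k) p) [:0, -1:] = smult ((-1) ^ k) ((pderiv ^^ k) (pcompose p [:0, -1:]))"
    for k and p :: "real poly"
  proof (induction k)
    case (Suc k)
    have "pderiv (pcompose ((pderiv ^^ k) p) [:0, -1:]) = - pcompose ((pderiv ^^ Suc k) p) [:0, -1:]"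
      by (simp add: pderiv_pcompose pderiv_pCons)
    then show ?case by (simp add: Suc pderiv_smult minus_equation_iff)
  qed simp
  have "pcompose endpoint_poly [:0, -1:] = endpoint_poly" by (simp add: endpoint_poly_def pcompose_pCons)
  then have "pcompose (endpoint_poly ^ n) [:0, -1:] = endpoint_poly ^ n"
    by (induction n) (simp_all add: pcompose_mult pcompose_1)
  then show ?thesis by (simp add: legendre_def pcompose_smult h mult.commute flip: endpoint_poly_def)
qed

text \<open>
  Legendre polynomials are even or odd, so the square of the derivative is even.
\<close>

lemma pderiv_legendre_reflect:
  "(poly (pderiv (legendre n)) (- x))\<^sup>2 = (poly (pderiv (legendre n)) x)\<^sup>2"
proof -
  have "poly (pderiv (pcompose (legendre n) [:0, -1:])) x = - poly (pderiv (legendre n)) (- x)"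
    by (simp add: pderiv_pcompose pderiv_pCons poly_pcompose)
  then have "poly (pderiv (legendre n)) (- x) = - ((-1) ^ n * poly (pderiv (legendre n)) x)"
    by (simp add: legendre_reflect pderiv_smult)
  then show ?thesis by (simp add: power_mult_distrib flip: power_mult)
qed

definition lagrange :: "nat \<Rightarrow> (nat \<Rightarrow> real) \<Rightarrow> nat \<Rightarrow> real poly" where
  "lagrange L \<xi> \<alpha> = (\<Prod>\<beta>\<in>{1..L} - {\<alpha>}. smult (1 / (\<xi> \<alpha> - \<xi> \<beta>)) [:- \<xi> \<beta>, 1:])"

lemma poly_lagrange: "poly (lagrange L \<xi> \<alpha>) x = (\<Prod>\<beta>\<in>{1..L} - {\<alpha>}. (x - \<xi> \<beta>) / (\<xi> \<alpha> - \<xi> \<beta>))"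
  unfolding lagrange_def poly_prod by (intro prod.cong) (auto simp: diff_divide_distrib)

lemma quad_weight_eq: "quad_weight L \<xi> \<alpha> = poly_integral (lagrange L \<xi> \<alpha>) / 2"
  by (simp add: quad_weight_def poly_integral_def poly_lagrange[abs_def])

lemma lagrange_interpolation:
  assumes inj: "inj_on \<xi> {1..L}" and deg: "degree r < L"
  shows "r = (\<Sum>\<alpha>\<in>{1..L}. smult (poly r (\<xi> \<alpha>)) (lagrange L \<xi> \<alpha>))"
proof (rule poly_eqI_degree[of "\<xi> ` {1..L}"])
  have kron: "poly (lagrange L \<xi> \<alpha>) (\<xi> \<beta>) = (if \<alpha> = \<beta> then 1 else 0)" if "\<alpha> \<in> {1..L}" "\<beta> \<in> {1..L}" for \<alpha> \<beta>
  proof (cases "\<alpha> = \<beta>")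
    case True
    have "\<xi> \<alpha> - \<xi> \<gamma> \<noteq> 0" if "\<gamma> \<in> {1..L} - {\<alpha>}" for \<gamma>
      using inj that \<open>\<alpha> \<in> {1..L}\<close> by (auto dest: inj_onD)
    then show ?thesis using True by (simp add: poly_lagrange)
  next
    case False
    then show ?thesis using that by (auto simp: poly_lagrange intro!: prod_zero)
  qed
  show "poly r x = poly (\<Sum>\<alpha>\<in>{1..L}. smult (poly r (\<xi> \<alpha>)) (lagrange L \<xi> \<alpha>)) x" if "x \<in> \<xi> ` {1..L}" for x
  proof -
    from \<open>x \<in> \<xi> ` {1..L}\<close> obtain \<beta> where \<beta>: "\<beta> \<in> {1..L}" "x = \<xi> \<beta>" by blast
    have "(\<Sum>\<alpha>\<in>{1..L}. poly r (\<xi> \<alpha>) * poly (lagrange L \<xi> \<alpha>) (\<xi> \<beta>)) = (\<Sum>\<alpha>\<in>{1..L}. if \<alpha> = \<beta> then poly r (\<xi> \<alpha>) else 0)"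
      by (intro sum.cong) (use kron \<beta> in auto)
    then show ?thesis using \<beta> by (simp add: poly_sum)
  qed
  have card: "card (\<xi> ` {1..L}) = L" using inj by (simp add: card_image)
  show "degree r < card (\<xi> ` {1..L})" using deg card by simp
  have "degree (lagrange L \<xi> \<alpha>) < L" if "\<alpha> \<in> {1..L}" for \<alpha>
  proof -
    have "degree (lagrange L \<xi> \<alpha>) \<le> (\<Sum>\<beta>\<in>{1..L} - {\<alpha>}. (degree \<circ> (\<lambda>\<beta>. smult (1 / (\<xi> \<alpha> - \<xi> \<beta>)) [:- \<xi> \<beta>, 1:])) \<beta>)"
      unfolding lagrange_def by (rule degree_prod_sum_le) simp
    also have "\<dots> \<le> (\<Sum>\<beta>\<in>{1..L} - {\<alpha>}. 1)" by (rule sum_mono) simp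
    also have "\<dots> < L" using that by simp
    finally show ?thesis .
  qed
  then show "degree (\<Sum>\<alpha>\<in>{1..L}. smult (poly r (\<xi> \<alpha>)) (lagrange L \<xi> \<alpha>)) < card (\<xi> ` {1..L})"
    unfolding card using deg by (intro degree_sum_less) (auto intro: le_less_trans[OF degree_smult_le])
qed

lemma lobatto_nodesD:
  assumes "gauss_lobatto_nodes L \<xi>"
  shows "L \<ge> 2" "inj_on \<xi> {1..L}" "\<xi> 1 = -1" "\<xi> L = 1"
    "\<And>\<alpha>. \<alpha> \<in> {1..L} \<Longrightarrow> -1 \<le> \<xi> \<alpha> \<and> \<xi> \<alpha> \<le> 1"
    "\<And>\<alpha>. \<alpha> \<in> {1<..<L} \<Longrightarrow> -1 < \<xi> \<alpha> \<and> \<xi> \<alpha> < 1"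
    "\<xi> ` {1<..<L} = {x. poly (pderiv (legendre (L - 1))) x = 0}"
proof -
  from assms show L: "L \<ge> 2" and e: "\<xi> 1 = -1" "\<xi> L = 1"
    and "\<xi> ` {1<..<L} = {x. poly (pderiv (legendre (L - 1))) x = 0}"
    by (auto simp: gauss_lobatto_nodes_def)
  from assms have m: "strict_mono_on {1..L} \<xi>" by (simp add: gauss_lobatto_nodes_def)
  then show "inj_on \<xi> {1..L}" by (rule strict_mono_on_imp_inj_on)
  show int: "-1 < \<xi> \<alpha> \<and> \<xi> \<alpha> < 1" if "\<alpha> \<in> {1<..<L}" for \<alpha>
    using strict_mono_onD[OF m, of 1 \<alpha>] strict_mono_onD[OF m, of \<alpha> L] that e by auto
  show "-1 \<le> \<xi> \<alpha> \<and> \<xi> \<alpha> \<le> 1" if "\<alpha> \<in> {1..L}" for \<alpha>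
  proof (cases "\<alpha> = 1 \<or> \<alpha> = L")
    case False
    then show ?thesis using int[of \<alpha>] that by auto
  qed (use e in auto)
qed

text \<open>
  Division by the node polynomial \<open>N = (x\<^sup>2 - 1) P'\<close> of degree \<open>L\<close>: the remainder is integrated
  exactly because the weights integrate its Lagrange interpolant, and \<open>N\<close> times the quotient has
  integral \<open>0\<close> by orthogonality and vanishes at the nodes.
\<close>

lemma lobatto_exact:
  assumes nodes: "gauss_lobatto_nodes L \<xi>" and deg: "degree p + 3 \<le> 2 * L"
  shows "poly_integral p = 2 * (\<Sum>\<alpha>\<in>{1..L}. quad_weight L \<xi> \<alpha> * poly p (\<xi> \<alpha>))"
proof -
  note nd = lobatto_nodesD[OF nodes]
  define N where "N = endpoint_poly * pderiv (legendre (L - 1))"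
  define q r where "q = p div N" and "r = p mod N"
  have P: "degree (pderiv (legendre (L - 1))) = L - 2"
    using nd(1) by (simp add: degree_pderiv degree_legendre)
  have Pnz: "pderiv (legendre (L - 1)) \<noteq> 0"
    using nd(1) by (simp add: pderiv_eq_0_iff degree_legendre)
  have degN: "degree N = L" and N: "N \<noteq> 0"
    using P Pnz nd(1) by (simp_all add: N_def degree_mult_eq)
  have pqr: "p = q * N + r" by (simp add: q_def r_def)
  have degr: "degree r < L"
    using degree_mod_less[OF N, of p] nd(1) degN by (auto simp: r_def)
  have Nz: "poly N (\<xi> \<alpha>) = 0" if "\<alpha> \<in> {1..L}" for \<alpha>
  proof (cases "\<alpha> = 1 \<or> \<alpha> = L")
    case False
    then have "\<xi> \<alpha> \<in> \<xi> ` {1<..<L}" using that by auto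
    then show ?thesis unfolding nd(7) by (simp add: N_def)
  qed (use nd in \<open>auto simp: N_def\<close>)
  have "poly_integral (q * N) = 0"
  proof (cases "q = 0")
    case False
    have "degree (q * N) \<le> degree p"
    proof (rule ccontr)
      assume "\<not> ?thesis"
      then have a: "degree p < degree (q * N)" by simp
      moreover have "degree (q * N) \<ge> L" using False N degN by (simp add: degree_mult_eq)
      ultimately have "degree (q * N + r) = degree (q * N)" using degr by (intro degree_add_eq_left) simp
      then show False using a pqr by simp
    qed
    then have "degree q + 2 \<le> L - 1" using False N degN deg nd(1) by (simp add: degree_mult_eq)
    then show ?thesis using lobatto_orthogonal[of q "L - 1"] by (simp add: N_def mult.commute)
  qed simp
  then have "poly_integral p = poly_integral r" by (subst pqr) (simp add: poly_integral_add)
  also have "\<dots> = (\<Sum>\<alpha>\<in>{1..L}. poly r (\<xi> \<alpha>) * (2 * quad_weight L \<xi> \<alpha>))"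
    by (subst lagrange_interpolation[OF nd(2) degr])
       (simp add: poly_integral_sum poly_integral_smult quad_weight_eq)
  also have "\<dots> = (\<Sum>\<alpha>\<in>{1..L}. poly p (\<xi> \<alpha>) * (2 * quad_weight L \<xi> \<alpha>))"
    using arg_cong[OF pqr, of "\<lambda>p. poly p (\<xi> _)"] Nz by (intro sum.cong refl) simp
  finally show ?thesis by (simp add: sum_distrib_left mult_ac)
qed

text \<open>
  The rule is exact for a nonnegative polynomial of degree \<open>2 L - 4\<close> that vanishes at every node
  but one.
\<close>

lemma lobatto_weight_nonneg:
  assumes nodes: "gauss_lobatto_nodes L \<xi>" and \<alpha>: "\<alpha> \<in> {1<..<L}"
  shows "quad_weight L \<xi> \<alpha> \<ge> 0"
proof -
  note nd = lobatto_nodesD[OF nodes]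
  define g where "g = (\<Prod>\<beta>\<in>{1<..<L} - {\<alpha>}. [:- \<xi> \<beta>, 1:])"
  define f where "f = - endpoint_poly * g\<^sup>2"
  have fx: "poly f x = (1 - x\<^sup>2) * (poly g x)\<^sup>2" for x
    by (simp add: f_def algebra_simps)
  have "degree g \<le> (\<Sum>\<beta>\<in>{1<..<L} - {\<alpha>}. (degree \<circ> (\<lambda>\<beta>. [:- \<xi> \<beta>, 1:])) \<beta>)"
    unfolding g_def by (rule degree_prod_sum_le) simp
  also have "\<dots> = L - 3" using \<alpha> by simp
  finally have "degree f \<le> 2 + 2 * (L - 3)"
    using degree_mult_le[of "- endpoint_poly" "g\<^sup>2"] degree_power_le[of g 2] by (simp add: f_def)
  then have deg: "degree f + 3 \<le> 2 * L" using \<alpha> by auto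
  have "poly f (\<xi> \<beta>) = 0" if "\<beta> \<in> {1..L} - {\<alpha>}" for \<beta>
  proof (cases "\<beta> = 1 \<or> \<beta> = L")
    case False
    then have "poly g (\<xi> \<beta>) = 0" using that by (auto simp: g_def poly_prod)
    then show ?thesis by (simp add: fx)
  qed (use nd in \<open>auto simp: fx\<close>)
  then have "(\<Sum>\<beta>\<in>{1..L}. quad_weight L \<xi> \<beta> * poly f (\<xi> \<beta>)) = quad_weight L \<xi> \<alpha> * poly f (\<xi> \<alpha>)"
    using \<alpha> by (subst sum.remove[of _ \<alpha>]) auto
  then have "poly_integral f = 2 * (quad_weight L \<xi> \<alpha> * poly f (\<xi> \<alpha>))"
    using lobatto_exact[OF nodes deg] by simp
  moreover have "poly_integral f \<ge> 0"
  proof (rule poly_integral_nonneg)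
    fix x :: real assume "-1 \<le> x" "x \<le> 1"
    then have "x\<^sup>2 \<le> 1" unfolding abs_square_le_1 by linarith
    then show "0 \<le> poly f x" by (simp add: fx)
  qed
  moreover have "poly f (\<xi> \<alpha>) > 0"
  proof -
    have "poly g (\<xi> \<alpha>) \<noteq> 0" using \<alpha> by (auto simp: g_def poly_prod dest!: inj_onD[OF nd(2)])
    moreover have "(\<xi> \<alpha>)\<^sup>2 < 1" using nd(6)[OF \<alpha>] unfolding abs_square_less_1 by linarith
    ultimately show ?thesis by (simp add: fx)
  qed
  ultimately show ?thesis by (simp add: zero_le_mult_iff)
qed

text \<open>
  The odd polynomial \<open>x (P')\<^sup>2\<close> vanishes at the interior nodes, has the largest degree \<open>2 L - 3\<close> for
  which the rule is exact, and takes opposite nonzero values at the two end points.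
\<close>

lemma lobatto_end_weights_eq:
  assumes nodes: "gauss_lobatto_nodes L \<xi>"
  shows "quad_weight L \<xi> L = quad_weight L \<xi> 1"
proof -
  note nd = lobatto_nodesD[OF nodes]
  define P where "P = pderiv (legendre (L - 1))"
  define f where "f = [:0, 1:] * P\<^sup>2"
  have "degree f \<le> 1 + 2 * (L - 2)"
    using degree_mult_le[of "[:0, 1:]" "P\<^sup>2"] degree_power_le[of P 2]
    by (simp add: f_def P_def degree_pderiv degree_legendre)
  then have deg: "degree f + 3 \<le> 2 * L" using nd(1) by linarith
  have fx: "poly f x = x * (poly P x)\<^sup>2" for x by (simp add: f_def)
  have odd: "poly f (- x) = - poly f x" for x
    using pderiv_legendre_reflect[of "L - 1" x] by (simp add: fx P_def)
  have "poly_integral f = integral {-1..1} (\<lambda>x. poly f (- x))"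
    unfolding poly_integral_def by (rule Henstock_Kurzweil_Integration.integral_reflect_real[of 1 "-1", simplified, symmetric])
  also have "\<dots> = - poly_integral f" by (simp add: odd poly_integral_def)
  finally have "poly_integral f = 0" by simp
  moreover have "poly f (\<xi> \<beta>) = 0" if "\<beta> \<in> {1..L} - {1, L}" for \<beta>
  proof -
    have "\<xi> \<beta> \<in> \<xi> ` {1<..<L}" using that by auto
    then show ?thesis unfolding nd(7) by (simp add: fx P_def)
  qed
  then have "(\<Sum>\<beta>\<in>{1..L}. quad_weight L \<xi> \<beta> * poly f (\<xi> \<beta>))
      = (\<Sum>\<beta>\<in>{1, L}. quad_weight L \<xi> \<beta> * poly f (\<xi> \<beta>))"
    using nd(1) by (intro sum.mono_neutral_right) auto
  ultimately have "quad_weight L \<xi> 1 * poly f (-1) + quad_weight L \<xi> L * poly f 1 = 0"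
    using lobatto_exact[OF nodes deg] nd by simp
  then have "(quad_weight L \<xi> L - quad_weight L \<xi> 1) * poly f 1 = 0"
    by (simp add: odd algebra_simps)
  moreover have "poly P 1 \<noteq> 0"
  proof
    assume "poly P 1 = 0"
    then have "1 \<in> \<xi> ` {1<..<L}" unfolding nd(7) by (simp add: P_def)
    then show False using nd(6) by force
  qed
  ultimately show ?thesis by (simp add: fx)
qed

lemma lobatto_weights_sum:
  assumes "gauss_lobatto_nodes L \<xi>"
  shows "(\<Sum>\<alpha>\<in>{1..L}. quad_weight L \<xi> \<alpha>) = 1"
proof -
  have "poly_integral 1 = 2" by (simp add: poly_integral_def poly_1[abs_def])
  then show ?thesis using lobatto_exact[OF assms, of 1] lobatto_nodesD(1)[OF assms] by simp
qed

lemma cell_average: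
  fixes f :: "real \<Rightarrow> 'a::euclidean_space"
  assumes nodes: "gauss_lobatto_nodes L \<xi>" and KL: "2 * L \<ge> K + 3"
    and dx: "\<Delta>x > 0" "xh j - xh (j - 1) = \<Delta>x" and f: "vec_poly K f"
  shows "(1 / \<Delta>x) *\<^sub>R integral (cell xh j) f
    = (\<Sum>\<alpha>\<in>{1..L}. quad_weight L \<xi> \<alpha> *\<^sub>R f (cell_node xh \<xi> j \<alpha>))"
proof -
  define h c where "h = \<Delta>x / 2" and "c = (xh (j - 1) + xh j) / 2"
  have h: "h > 0" using dx by (simp add: h_def)
  have node: "cell_node xh \<xi> j \<alpha> = c + h * \<xi> \<alpha>" for \<alpha>
    using dx by (simp add: cell_node_def h_def c_def)
  obtain C where C: "\<And>x. f x = (\<Sum>k\<le>K. x ^ k *\<^sub>R C k)" using f by (auto simp: vec_poly_def)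
  have mono: "((\<lambda>x. x ^ k) has_integral \<Delta>x * (\<Sum>\<alpha>\<in>{1..L}. quad_weight L \<xi> \<alpha> * cell_node xh \<xi> j \<alpha> ^ k)) (cell xh j)"
    if "k \<le> K" for k
  proof -
    define p where "p = [:c, h:] ^ k"
    have "degree p \<le> degree [:c, h:] * k" unfolding p_def by (rule degree_power_le)
    also have "\<dots> \<le> 1 * k" by (intro mult_right_mono) auto
    finally have deg: "degree p + 3 \<le> 2 * L" using that KL by simp
    have px: "poly p x = (h * x + c) ^ k" for x by (simp add: p_def add.commute mult.commute)
    have "(poly p has_integral poly_integral p) {-1..1}"
      unfolding poly_integral_def by (rule integrable_integral[OF integrable_poly])
    moreover have "(xh (j - 1) - c) /\<^sub>R h = -1" "(xh j - c) /\<^sub>R h = 1"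
      using h dx by (simp_all add: h_def c_def field_simps)
    moreover have "(h * poly_integral p) /\<^sub>R h ^ DIM(real) = poly_integral p" using h by simp
    ultimately have "((\<lambda>x. (h *\<^sub>R x + c) ^ k) has_integral (h * poly_integral p) /\<^sub>R h ^ DIM(real))
        (cbox ((xh (j - 1) - c) /\<^sub>R h) ((xh j - c) /\<^sub>R h))"
      by (simp only: px[abs_def] real_scaleR_def box_real)
    then have "((\<lambda>x. x ^ k) has_integral h * poly_integral p) (cbox (xh (j - 1)) (xh j))"
      by (rule iffD1[OF has_integral_affinity_iff[OF h, of "\<lambda>x. x ^ k" c]])
    then have "((\<lambda>x. x ^ k) has_integral h * poly_integral p) (cell xh j)"
      by (simp add: cell_def has_integral_Icc_iff_Ioo)
    moreover have "h * poly_integral p = \<Delta>x * (\<Sum>\<alpha>\<in>{1..L}. quad_weight L \<xi> \<alpha> * cell_node xh \<xi> j \<alpha> ^ k)"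
      unfolding lobatto_exact[OF nodes deg] px node by (simp add: h_def add.commute)
    ultimately show ?thesis by simp
  qed
  have "(f has_integral (\<Sum>k\<le>K. (\<Delta>x * (\<Sum>\<alpha>\<in>{1..L}. quad_weight L \<xi> \<alpha> * cell_node xh \<xi> j \<alpha> ^ k)) *\<^sub>R C k)) (cell xh j)"
    unfolding C[abs_def] by (intro has_integral_sum has_integral_scaleR_left mono) auto
  also have "(\<Sum>k\<le>K. (\<Delta>x * (\<Sum>\<alpha>\<in>{1..L}. quad_weight L \<xi> \<alpha> * cell_node xh \<xi> j \<alpha> ^ k)) *\<^sub>R C k)
     = \<Delta>x *\<^sub>R (\<Sum>\<alpha>\<in>{1..L}. quad_weight L \<xi> \<alpha> *\<^sub>R f (cell_node xh \<xi> j \<alpha>))"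
    unfolding C scaleR_sum_right scaleR_sum_left sum_distrib_left scaleR_scaleR mult.assoc by (rule sum.swap)
  finally show ?thesis using dx by (simp add: integral_unique)
qed

section \<open>Inequalities for velocities and magnetic fields\<close>

text \<open>
  Project \<open>b\<close> and \<open>c\<close> to the orthogonal complement of \<open>a\<close>: up to a power of \<open>a \<bullet> a\<close>, the
  determinant of the three vectors is that of the two projections, which is nonnegative by the
  Cauchy--Schwarz inequality.
\<close>

lemma gram_det_nonneg:
  fixes a b c :: "'a::real_inner"
  shows "0 \<le> (a \<bullet> a) * ((b \<bullet> b) * (c \<bullet> c) - (b \<bullet> c)\<^sup>2) - (a \<bullet> b) * ((a \<bullet> b) * (c \<bullet> c) - (b \<bullet> c) * (a \<bullet> c))
    + (a \<bullet> c) * ((a \<bullet> b) * (b \<bullet> c) - (b \<bullet> b) * (a \<bullet> c))" (is "0 \<le> ?G")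
proof (cases "a = 0")
  case False
  let ?b = "(a \<bullet> a) *\<^sub>R b - (a \<bullet> b) *\<^sub>R a" and ?c = "(a \<bullet> a) *\<^sub>R c - (a \<bullet> c) *\<^sub>R a"
  have ip: "((a \<bullet> a) *\<^sub>R y - (a \<bullet> y) *\<^sub>R a) \<bullet> ((a \<bullet> a) *\<^sub>R z - (a \<bullet> z) *\<^sub>R a)
      = (a \<bullet> a) * ((a \<bullet> a) * (y \<bullet> z) - (a \<bullet> y) * (a \<bullet> z))" for y z
    by (simp add: inner_diff_left inner_diff_right inner_commute[of y a] algebra_simps)
  have alg: "(a * (a * b - ab * ab)) * (a * (a * c - ac * ac)) - (a * (a * bc - ab * ac))\<^sup>2
      = a^3 * (a * (b * c - bc\<^sup>2) - ab * (ab * c - bc * ac) + ac * (ab * bc - b * ac))"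
    for a b c ab ac bc :: real
    by algebra
  have "(?b \<bullet> ?c)\<^sup>2 \<le> (?b \<bullet> ?b) * (?c \<bullet> ?c)"
    by (rule Cauchy_Schwarz_ineq)
  then have "0 \<le> (a \<bullet> a)^3 * ?G"
    unfolding ip alg[symmetric] by simp
  moreover have "a \<bullet> a > 0" using False by simp
  ultimately show ?thesis
    by (simp add: zero_le_mult_iff)
qed simp

text \<open>
  The left-hand side is what remains of the magnetic part after completing a square; the variables
  stand for the inner products of \<open>v\<close>, \<open>w\<close>, \<open>B\<close> and a unit vector \<open>e\<close>, with \<open>x = e \<bullet> B\<close>. On the
  right are the Gram determinant of \<open>B\<close>, \<open>w - v\<close>, \<open>e - v\<close>, and that of the components of
  \<open>B\<close>, \<open>v\<close>, \<open>w\<close> orthogonal to \<open>e\<close>. In space, the latter are three vectors in a plane, so that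
  their determinant is \<open>0\<close>.
\<close>

lemma magnetic_remainder:
  fixes BB vB wB vv ww vw ev ew x :: real
  shows "2 * (1 - ew) * (BB * (1 - ev) * (1 - vw) - ((1 - vv) * BB + vB\<^sup>2) / 2 * (1 - ew) + x * vB * (1 - vw)
     + wB * ((1 - ev) * vB - x * (1 - vv))) 
   - ((1 - ww) * ((1 - ev)\<^sup>2 * BB + 2 * (1 - ev) * x * (vB - wB) + x\<^sup>2 * (vv - 2 * vw + ww)) + ((1 - ev) * wB + x * (vw - ww))\<^sup>2)
  = BB * ((ww - 2 * vw + vv) * (1 - 2 * ev + vv) - (ew - vw - ev + vv)\<^sup>2)
    - (wB - vB) * ((wB - vB) * (1 - 2 * ev + vv) - (ew - vw - ev + vv) * (x - vB))
    + (x - vB) * ((wB - vB) * (ew - vw - ev + vv) - (ww - 2 * vw + vv) * (x - vB))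
   - ((BB - x\<^sup>2) * ((vv - ev\<^sup>2) * (ww - ew\<^sup>2) - (vw - ev * ew)\<^sup>2)
       - (vB - x * ev) * ((vB - x * ev) * (ww - ew\<^sup>2) - (vw - ev * ew) * (wB - x * ew))
       + (wB - x * ew) * ((vB - x * ev) * (vw - ev * ew) - (vv - ev\<^sup>2) * (wB - x * ew)))"
  by (simp add: power2_eq_square field_simps)

lemma planar_gram:
  fixes a b c d e f :: real
  shows "(a * a + b * b) * ((c * c + d * d) * (e * e + f * f) - (c * e + d * f)\<^sup>2)
    - (a * c + b * d) * ((a * c + b * d) * (e * e + f * f) - (c * e + d * f) * (a * e + b * f))
    + (a * e + b * f) * ((a * c + b * d) * (c * e + d * f) - (c * c + d * d) * (a * e + b * f)) = 0"
  by (simp add: power2_eq_square algebra_simps)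

text \<open>
  The expression is a quadratic polynomial in \<open>C\<close> whose leading form is positive definite.
  Completing the square leaves a remainder independent of \<open>C\<close>, which is a Gram determinant and
  hence nonnegative.
\<close>

lemma magnetic_part_nonneg:
  fixes v w B C :: "real^3"
  assumes \<kappa>: "\<kappa>\<^sup>2 = 1" and w: "norm w < 1"
  defines "s \<equiv> 1 - \<kappa> * v$1" and "t \<equiv> 1 - \<kappa> * w$1" and "q \<equiv> 1 - v \<bullet> w" and "x \<equiv> \<kappa> * B$1"
  defines "Y \<equiv> s *\<^sub>R B + x *\<^sub>R (v - w)"
  shows "0 \<le> (B \<bullet> B) * s * q - ((1 - v \<bullet> v) * (B \<bullet> B) + (v \<bullet> B)\<^sup>2) / 2 * t + x * (v \<bullet> B) * q
     + (w \<bullet> B) * (s * (v \<bullet> B) - x * (1 - v \<bullet> v))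
     - ((1 - w \<bullet> w) * (C \<bullet> Y) + (w \<bullet> C) * (w \<bullet> Y))
     + ((1 - w \<bullet> w) * (C \<bullet> C) + (w \<bullet> C)\<^sup>2) / 2 * t" (is "0 \<le> ?M")
proof -
  let ?Z = "t *\<^sub>R C - Y"
  define e :: "real^3" where "e = axis 1 \<kappa>"
  have e: "e \<bullet> y = \<kappa> * y$1" for y
    by (simp add: e_def inner_axis')
  have ee: "e \<bullet> e = 1" using \<kappa> e[of e] by (simp add: e_def power2_eq_square)
  \<comment> \<open>The three vectors whose Gram determinant is the remainder.\<close>
  let ?a = "B" and ?b = "w - v" and ?c = "e - v"
  let ?G = "(?a \<bullet> ?a) * ((?b \<bullet> ?b) * (?c \<bullet> ?c) - (?b \<bullet> ?c)\<^sup>2) - (?a \<bullet> ?b) * ((?a \<bullet> ?b) * (?c \<bullet> ?c) - (?b \<bullet> ?c) * (?a \<bullet> ?c))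
    + (?a \<bullet> ?c) * ((?a \<bullet> ?b) * (?b \<bullet> ?c) - (?b \<bullet> ?b) * (?a \<bullet> ?c))"
  have G: "0 \<le> ?G" by (rule gram_det_nonneg)
  have complete_square: "2 * t * (N - L + P / 2 * t) = t\<^sup>2 * P - 2 * t * L + Q + (2 * t * N - Q)" for N L P Q :: real
    by (simp add: power2_eq_square algebra_simps)
  have ww: "w \<bullet> w < 1" using w by (simp add: norm_eq_sqrt_inner)
  have "\<bar>e \<bullet> w\<bar> \<le> norm e * norm w" by (rule Cauchy_Schwarz_ineq2)
  also have "norm e = 1" using ee by (simp add: norm_eq_sqrt_inner)
  finally have t: "t > 0" using w by (simp add: t_def e)
  have nonneg: "0 \<le> y" if "0 \<le> 2 * t * y" for y
    using that t by (simp add: zero_le_mult_iff)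
  \<comment> \<open>The square that is completed, for the quadratic form \<open>(1 - |w|\<^sup>2) |z|\<^sup>2 + (w \<bullet> z)\<^sup>2\<close>.\<close>
  have sq: "(1 - w \<bullet> w) * (?Z \<bullet> ?Z) + (w \<bullet> ?Z)\<^sup>2 =
      t\<^sup>2 * ((1 - w \<bullet> w) * (C \<bullet> C) + (w \<bullet> C)\<^sup>2) - 2 * t * ((1 - w \<bullet> w) * (C \<bullet> Y) + (w \<bullet> C) * (w \<bullet> Y))
      + ((1 - w \<bullet> w) * (Y \<bullet> Y) + (w \<bullet> Y)\<^sup>2)"
    by (simp add: inner_diff_left inner_diff_right inner_commute[of Y C] power2_eq_square algebra_simps)
  have YY: "Y \<bullet> Y = s\<^sup>2 * (B \<bullet> B) + 2 * s * x * (v \<bullet> B - w \<bullet> B) + x\<^sup>2 * (v \<bullet> v - 2 * (v \<bullet> w) + w \<bullet> w)"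
  proof -
    have "Y \<bullet> Y = s * (s * (B \<bullet> B) + x * (v \<bullet> B - w \<bullet> B)) +
        x * (s * (v \<bullet> B) + x * (v \<bullet> v - v \<bullet> w) - (s * (w \<bullet> B) + x * (v \<bullet> w - w \<bullet> w)))"
      unfolding Y_def inner_add_left inner_add_right inner_diff_left inner_diff_right inner_scaleR_left
        inner_scaleR_right inner_commute[of w v] inner_commute[of B v] inner_commute[of B w] ..
    also have "\<dots> = s\<^sup>2 * (B \<bullet> B) + 2 * s * x * (v \<bullet> B - w \<bullet> B) + x\<^sup>2 * (v \<bullet> v - 2 * (v \<bullet> w) + w \<bullet> w)"
      by (simp add: power2_eq_square algebra_simps)
    finally show ?thesis .
  qed
  have wY: "w \<bullet> Y = s * (w \<bullet> B) + x * (v \<bullet> w - w \<bullet> w)"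
    unfolding Y_def by (simp add: inner_diff_right inner_add_right inner_commute[of w v])
  have perp: "(y \<bullet> z - (\<kappa> * y$1) * (\<kappa> * z$1)) = y$2 * z$2 + y$3 * z$3" for y z :: "real^3"
  proof -
    have "(\<kappa> * y$1) * (\<kappa> * z$1) = \<kappa>\<^sup>2 * (y$1 * z$1)" by algebra
    then show ?thesis using \<kappa> by (simp add: inner_vec_def sum_3)
  qed
  have perp2: "(y \<bullet> y - (\<kappa> * y$1)\<^sup>2) = y$2 * y$2 + y$3 * y$3" for y :: "real^3"
    using perp[of y y] by (simp add: power2_eq_square)
  \<comment> \<open>The components orthogonal to \<open>e\<close> lie in the plane of the last two coordinates.\<close>
  have plane: "((B \<bullet> B - x\<^sup>2) * ((v \<bullet> v - (\<kappa> * v$1)\<^sup>2) * (w \<bullet> w - (\<kappa> * w$1)\<^sup>2) - (v \<bullet> w - (\<kappa> * v$1) * (\<kappa> * w$1))\<^sup>2)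
       - (v \<bullet> B - x * (\<kappa> * v$1)) * ((v \<bullet> B - x * (\<kappa> * v$1)) * (w \<bullet> w - (\<kappa> * w$1)\<^sup>2) - (v \<bullet> w - (\<kappa> * v$1) * (\<kappa> * w$1)) * (w \<bullet> B - x * (\<kappa> * w$1)))
       + (w \<bullet> B - x * (\<kappa> * w$1)) * ((v \<bullet> B - x * (\<kappa> * v$1)) * (v \<bullet> w - (\<kappa> * v$1) * (\<kappa> * w$1)) - (v \<bullet> v - (\<kappa> * v$1)\<^sup>2) * (w \<bullet> B - x * (\<kappa> * w$1)))) = 0"
    unfolding x_def inner_commute[of v B] inner_commute[of w B] perp perp2 by (rule planar_gram)
  have GG: "?G = (B \<bullet> B) * ((w \<bullet> w - 2 * (v \<bullet> w) + v \<bullet> v) * (1 - 2 * (\<kappa> * v$1) + v \<bullet> v) - ((\<kappa> * w$1) - v \<bullet> w - (\<kappa> * v$1) + v \<bullet> v)\<^sup>2)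
    - (w \<bullet> B - v \<bullet> B) * ((w \<bullet> B - v \<bullet> B) * (1 - 2 * (\<kappa> * v$1) + v \<bullet> v) - ((\<kappa> * w$1) - v \<bullet> w - (\<kappa> * v$1) + v \<bullet> v) * (x - v \<bullet> B))
    + (x - v \<bullet> B) * ((w \<bullet> B - v \<bullet> B) * ((\<kappa> * w$1) - v \<bullet> w - (\<kappa> * v$1) + v \<bullet> v) - (w \<bullet> w - 2 * (v \<bullet> w) + v \<bullet> v) * (x - v \<bullet> B))"
  proof -
    have 1: "?b \<bullet> ?b = w \<bullet> w - 2 * (v \<bullet> w) + v \<bullet> v"
      by (simp add: inner_diff_left inner_diff_right inner_commute[of w v])
    have 2: "?c \<bullet> ?c = 1 - 2 * (\<kappa> * v$1) + v \<bullet> v"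
      by (simp add: inner_diff_left inner_diff_right inner_commute[of v e] ee e[of v])
    have 3: "?b \<bullet> ?c = (\<kappa> * w$1) - v \<bullet> w - (\<kappa> * v$1) + v \<bullet> v"
      by (simp add: inner_diff_left inner_diff_right inner_commute[of v e] inner_commute[of w e] inner_commute[of w v] e)
    have 4: "?a \<bullet> ?b = w \<bullet> B - v \<bullet> B" "?a \<bullet> ?c = x - v \<bullet> B"
      by (simp_all add: inner_diff_right inner_commute[of B] e x_def)
    show ?thesis unfolding 1 2 3 4 ..
  qed
  have R: "2 * t * ((B \<bullet> B) * s * q - ((1 - v \<bullet> v) * (B \<bullet> B) + (v \<bullet> B)\<^sup>2) / 2 * t + x * (v \<bullet> B) * q
     + (w \<bullet> B) * (s * (v \<bullet> B) - x * (1 - v \<bullet> v))) - ((1 - w \<bullet> w) * (Y \<bullet> Y) + (w \<bullet> Y)\<^sup>2) = ?G"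
    using magnetic_remainder[of "\<kappa> * w$1" "B \<bullet> B" "\<kappa> * v$1" "v \<bullet> w" "v \<bullet> v" "v \<bullet> B" x "w \<bullet> B" "w \<bullet> w"]
    unfolding YY wY s_def t_def q_def plane GG by (simp only: diff_zero)
  have "2 * t * ?M = ((1 - w \<bullet> w) * (?Z \<bullet> ?Z) + (w \<bullet> ?Z)\<^sup>2) + ?G"
    unfolding sq R[symmetric] by (rule complete_square)
  moreover have "0 \<le> \<dots>" using ww by (intro add_nonneg_nonneg mult_nonneg_nonneg G) auto
  ultimately have "0 \<le> 2 * t * ?M" by (simp only:)
  then show ?thesis by (rule nonneg)
qed

lemma inner_self_less_one: "norm v < 1 \<Longrightarrow> v \<bullet> v < 1"
  by (simp add: norm_eq_sqrt_inner)

text \<open>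
  The relative Lorentz factor of two velocities is at least \<open>1\<close>: the Cauchy--Schwarz inequality for
  the unit vectors \<open>(sqrt (1 - |v|\<^sup>2), v)\<close> and \<open>(sqrt (1 - |w|\<^sup>2), w)\<close>.
\<close>

lemma lorentz_factor_ge_one:
  fixes v w :: "'a::real_inner"
  assumes "norm v < 1" "norm w < 1"
  shows "sqrt (1 - v \<bullet> v) * sqrt (1 - w \<bullet> w) \<le> 1 - v \<bullet> w"
proof -
  have "(sqrt (1 - v \<bullet> v), v) \<bullet> (sqrt (1 - w \<bullet> w), w) \<le> norm (sqrt (1 - v \<bullet> v), v) * norm (sqrt (1 - w \<bullet> w), w)"
    by (rule norm_cauchy_schwarz)
  also have "\<dots> = 1"
    using assms[THEN inner_self_less_one] by (simp add: norm_Pair flip: dot_square_norm)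
  finally show ?thesis by simp
qed

text \<open>
  In spacetime, reflecting the four-velocity of \<open>w\<close> at that of \<open>v\<close> gives again a future timelike
  vector, which pairs strictly with the null vector \<open>(1, e)\<close>. In the present coordinates the
  difference of the two sides is affine in \<open>w\<close>, and the norm of its gradient equals its constant
  term, so that it is positive in the open unit ball.
\<close>

lemma reflected_velocity_bound:
  fixes e v w :: "'a::real_inner"
  assumes e: "e \<bullet> e = 1" and v: "norm v < 1" and w: "norm w < 1"
  shows "(1 - e \<bullet> w) * (1 - v \<bullet> v) < 2 * (1 - e \<bullet> v) * (1 - v \<bullet> w)"
proof -
  define s g where "s = 1 - e \<bullet> v" and "g = 1 - v \<bullet> v"
  let ?r = "(2 * s) *\<^sub>R v - g *\<^sub>R e"
  have "e \<noteq> v" using e v by (auto simp: norm_eq_sqrt_inner)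
  moreover have "(e - v) \<bullet> (e - v) = 2 * s - g"
    using e by (simp add: s_def g_def inner_diff_left inner_diff_right inner_commute[of v e])
  moreover have "0 < (e - v) \<bullet> (e - v)" using \<open>e \<noteq> v\<close> by simp
  ultimately have pos: "2 * s - g > 0" by simp
  have "?r \<bullet> ?r = 4 * s\<^sup>2 * (v \<bullet> v) - 4 * s * g * (e \<bullet> v) + g\<^sup>2"
    using e by (simp add: inner_diff_left inner_diff_right inner_commute[of v e] power2_eq_square algebra_simps)
  also have "\<dots> = (2 * s - g)\<^sup>2"
    by (simp add: s_def g_def power2_eq_square algebra_simps)
  finally have nr: "norm ?r = 2 * s - g"
    using pos by (simp add: norm_eq_sqrt_inner)
  have "?r \<bullet> w \<le> norm ?r * norm w" by (rule norm_cauchy_schwarz)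
  also have "\<dots> < 2 * s - g" unfolding nr using pos w by simp
  finally show ?thesis
    by (simp add: s_def g_def inner_diff_left algebra_simps)
qed

text \<open>
  Here \<open>\<Gamma> \<le> 2\<close> enters, as \<open>\<Gamma> / (\<Gamma> - 1) \<ge> 2\<close>: the pressure terms are then dominated by the
  reflection bound, and the density terms by the bound on the relative Lorentz factor.
\<close>

lemma hydro_part_pos:
  fixes v w :: "real^3"
  assumes \<Gamma>: "1 < \<Gamma>" "\<Gamma> \<le> 2" and \<kappa>: "\<kappa>\<^sup>2 = 1" and v: "norm v < 1" and w: "norm w < 1"
    and pos: "\<rho> > 0" "p > 0"
    and H: "H = (\<rho> + \<Gamma> / (\<Gamma> - 1) * p) / (1 - v \<bullet> v)"
  shows "0 < H * (1 - \<kappa> * v$1) * (1 - v \<bullet> w) - p * (1 - \<kappa> * w$1)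
     - sqrt (1 - w \<bullet> w) * (\<rho> / sqrt (1 - v \<bullet> v)) * (1 - \<kappa> * v$1)"
proof -
  define e :: "real^3" where "e = axis 1 \<kappa>"
  have e: "e \<bullet> y = \<kappa> * y$1" for y by (simp add: e_def inner_axis')
  have ee: "e \<bullet> e = 1" using \<kappa> e[of e] by (simp add: e_def power2_eq_square)
  define g where "g = 1 - v \<bullet> v"
  define s where "s = 1 - \<kappa> * v$1"
  define q where "q = 1 - v \<bullet> w"
  have g: "g > 0" using inner_self_less_one[OF v] by (simp add: g_def)
  have "\<bar>e \<bullet> v\<bar> \<le> norm e * norm v" by (rule Cauchy_Schwarz_ineq2)
  also have "norm e = 1" using ee by (simp add: norm_eq_sqrt_inner)
  finally have s: "s > 0" using v by (simp add: s_def e)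
  have "\<bar>v \<bullet> w\<bar> \<le> norm v * norm w" by (rule Cauchy_Schwarz_ineq2)
  also have "\<dots> < 1" using v w by (metis mult_less_cancel_right2 mult_strict_mono' norm_ge_zero one_power2 power2_eq_square)
  finally have q: "q > 0" by (simp add: q_def)
  have a: "sqrt g * sqrt (1 - w \<bullet> w) \<le> q" using lorentz_factor_ge_one[OF v w] by (simp add: g_def q_def)
  have b: "(1 - \<kappa> * w$1) * g < 2 * s * q"
    using reflected_velocity_bound[OF ee v w] by (simp add: e s_def g_def q_def)
  have c: "\<Gamma> / (\<Gamma> - 1) \<ge> 2" using \<Gamma> by (simp add: field_simps)
  have "sqrt (1 - w \<bullet> w) * (\<rho> / sqrt g) * s * g = \<rho> * s * (sqrt g * sqrt (1 - w \<bullet> w))"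
    using g by (simp add: field_simps)
  also have "\<dots> \<le> \<rho> * s * q"
    using a pos s by (intro mult_left_mono) auto
  finally have 1: "sqrt (1 - w \<bullet> w) * (\<rho> / sqrt g) * s * g \<le> \<rho> * s * q" .
  have "p * ((1 - \<kappa> * w$1) * g) < p * (2 * s * q)" using b pos by simp
  also have "\<dots> \<le> \<Gamma> / (\<Gamma> - 1) * (p * s * q)"
    using mult_right_mono[OF c, of "p * s * q"] pos s q by simp
  finally have 2: "p * (1 - \<kappa> * w$1) * g < \<Gamma> / (\<Gamma> - 1) * p * s * q" by (simp add: mult.assoc)
  have "H * g = \<rho> + \<Gamma> / (\<Gamma> - 1) * p" using g by (simp add: H g_def)
  then have "H * s * q * g = \<rho> * s * q + \<Gamma> / (\<Gamma> - 1) * p * s * q"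
    by algebra
  then have "0 < (H * s * q - p * (1 - \<kappa> * w$1) - sqrt (1 - w \<bullet> w) * (\<rho> / sqrt g) * s) * g"
    using 1 2 by (simp add: left_diff_distrib)
  then show ?thesis using g by (simp add: zero_less_mult_iff s_def q_def g_def)
qed

section \<open>Admissible states lie in half-spaces\<close>

lemma lorentz_sq:
  assumes "norm v < 1"
  shows "(lorentz v)\<^sup>2 = 1 / (1 - v \<bullet> v)"
  using inner_self_less_one[OF assms] by (simp add: lorentz_def power_divide dot_square_norm)

lemma mag_pressure_eq:
  assumes "norm v < 1"
  shows "mag_pressure v B = ((1 - v \<bullet> v) * (B \<bullet> B) + (v \<bullet> B)\<^sup>2) / 2"
  unfolding mag_pressure_def lorentz_sq[OF assms] by (simp add: dot_square_norm mult.commute)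

lemma rho_enthalpy:
  assumes "1 < \<Gamma>" "\<rho> > 0"
  shows "\<rho> * enthalpy \<Gamma> \<rho> p = \<rho> + \<Gamma> / (\<Gamma> - 1) * p"
  using assms by (simp add: enthalpy_def int_energy_def field_simps)

text \<open>
  The conservative variables in terms of \<open>H = \<rho> h W\<^sup>2\<close>; the Lorentz factor survives only in \<open>D\<close>.
\<close>

lemma cons_of_prim_eq:
  assumes "1 < \<Gamma>" "\<rho> > 0" "norm v < 1"
    and H: "H = (\<rho> + \<Gamma> / (\<Gamma> - 1) * p) / (1 - v \<bullet> v)"
  shows "cons_of_prim \<Gamma> (\<rho>, v, B, p) =
    (\<rho> / sqrt (1 - v \<bullet> v), (H + B \<bullet> B) *\<^sub>R v - (v \<bullet> B) *\<^sub>R B, B,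
     H - p - mag_pressure v B + B \<bullet> B)"
proof -
  have "\<rho> * enthalpy \<Gamma> \<rho> p * (lorentz v)\<^sup>2 = H"
    by (simp only: rho_enthalpy[OF assms(1,2)] lorentz_sq[OF assms(3)] H mult_1_right times_divide_eq_right)
  moreover have "\<rho> * lorentz v = \<rho> / sqrt (1 - v \<bullet> v)"
    by (simp add: lorentz_def dot_square_norm)
  ultimately show ?thesis
    by (simp add: cons_of_prim_def Let_def tot_pressure_def scaleR_add_left flip: dot_square_norm)
qed

text \<open>
  The flux is defined through a chosen primitive preimage. As the choice reproduces \<open>U\<close>, the flux
  and the conservative state can be expressed in the same primitive variables.
\<close>

lemma admissible_fluxE:
  assumes "1 < \<Gamma>" "U \<in> admissible \<Gamma>"
  obtains \<rho> v B p H m D where "\<rho> > 0" "p > 0" "norm v < 1"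
    "H = (\<rho> + \<Gamma> / (\<Gamma> - 1) * p) / (1 - v \<bullet> v)"
    "D = \<rho> / sqrt (1 - v \<bullet> v)" "m = (H + B \<bullet> B) *\<^sub>R v - (v \<bullet> B) *\<^sub>R B"
    "U = (D, m, B, H - p - mag_pressure v B + B \<bullet> B)"
    "flux1 \<Gamma> U = (D * v$1,
       v$1 *\<^sub>R m - B$1 *\<^sub>R ((1 - v \<bullet> v) *\<^sub>R B + (v \<bullet> B) *\<^sub>R v) + (p + mag_pressure v B) *\<^sub>R axis 1 1,
       v$1 *\<^sub>R B - B$1 *\<^sub>R v, m$1)"
proof -
  obtain \<rho> v B p where P: "prim_of_cons \<Gamma> U = (\<rho>, v, B, p)"
    by (cases "prim_of_cons \<Gamma> U") auto
  have "prim_of_cons \<Gamma> U \<in> prim_states"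
    using assms(2) unfolding prim_of_cons_def admissible_def by (rule inv_into_into)
  then have pos: "\<rho> > 0" "p > 0" "norm v < 1" by (auto simp: prim_states_def P)
  define H where "H = (\<rho> + \<Gamma> / (\<Gamma> - 1) * p) / (1 - v \<bullet> v)"
  define D where "D = \<rho> / sqrt (1 - v \<bullet> v)"
  define m where "m = (H + B \<bullet> B) *\<^sub>R v - (v \<bullet> B) *\<^sub>R B"
  have "cons_of_prim \<Gamma> (prim_of_cons \<Gamma> U) = U"
    using assms(2) unfolding prim_of_cons_def admissible_def by (rule f_inv_into_f)
  then have U: "U = (D, m, B, H - p - mag_pressure v B + B \<bullet> B)"
    using cons_of_prim_eq[OF assms(1) pos(1,3) H_def, of B] by (simp add: P D_def m_def)
  have "flux1 \<Gamma> U = (D * v$1,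
       v$1 *\<^sub>R m - B$1 *\<^sub>R ((1 - v \<bullet> v) *\<^sub>R B + (v \<bullet> B) *\<^sub>R v) + (p + mag_pressure v B) *\<^sub>R axis 1 1,
       v$1 *\<^sub>R B - B$1 *\<^sub>R v, m$1)"
    using inner_self_less_one[OF pos(3)] unfolding flux1_def P lorentz_sq[OF pos(3)] tot_pressure_def
    by (simp add: U lorentz_sq[OF pos(3)])
  then show ?thesis
    by (rule that[OF pos H_def D_def m_def U])
qed

text \<open>
  Normal of the half-space that is indexed by a velocity \<open>w\<close> and a magnetic field \<open>C\<close>. The boundary
  \<open>U \<bullet> dual_vec w C + mag_pressure w C = 0\<close> contains the zero-pressure states with this velocity
  and this field, which are limits of admissible states.
\<close>

definition dual_vec :: "real^3 \<Rightarrow> real^3 \<Rightarrow> cons" where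
  "dual_vec w C = (- sqrt (1 - w \<bullet> w), - w, - ((1 - w \<bullet> w) *\<^sub>R C + (w \<bullet> C) *\<^sub>R w), 1)"

lemma inner_dual_vec:
  "(D, m, B, E) \<bullet> dual_vec w C
     = E - sqrt (1 - w \<bullet> w) * D - w \<bullet> m - ((1 - w \<bullet> w) * (C \<bullet> B) + (w \<bullet> C) * (w \<bullet> B))"
  by (simp add: dual_vec_def inner_diff_right inner_add_right inner_commute[of B] inner_commute[of m])

text \<open>
  Separates the corrected half-space functional on \<open>U - \<kappa> F(U)\<close> into its hydrodynamic and its magnetic part.
  The variables stand for the inner products that occur (\<open>vw\<close> for \<open>v \<bullet> w\<close>, etc.), \<open>r\<close> for
  \<open>sqrt (1 - |w|\<^sup>2)\<close>, and \<open>P\<close>, \<open>pC\<close> for the two magnetic pressures.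
\<close>

lemma splitting_algebra:
  fixes D :: real
  shows "(H - p - P + BB) - r * D - ((H + BB) * vw - vB * wB) - ((1 - ww) * CB + wC * wB)
   - \<kappa> * (((H + BB) * v1 - vB * B1) - r * (D * v1)
     - (v1 * ((H + BB) * vw - vB * wB) - B1 * ((1 - vv) * wB + vB * vw) + (p + P) * w1)
     - ((1 - ww) * (v1 * CB - B1 * Cv) + wC * (v1 * wB - B1 * vw)))
   + pC - \<kappa> * (w1 * pC - B1 * wC)
   = (H * (1 - \<kappa> * v1) * (1 - vw) - p * (1 - \<kappa> * w1) - r * D * (1 - \<kappa> * v1)) +
     (BB * (1 - \<kappa> * v1) * (1 - vw) - P * (1 - \<kappa> * w1) + (\<kappa> * B1) * vB * (1 - vw)
     + wB * ((1 - \<kappa> * v1) * vB - (\<kappa> * B1) * (1 - vv))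
     - ((1 - ww) * ((1 - \<kappa> * v1) * CB + (\<kappa> * B1) * (Cv - wC)) + wC * ((1 - \<kappa> * v1) * wB + (\<kappa> * B1) * (vw - ww)))
     + pC * (1 - \<kappa> * w1))"
  by algebra

text \<open>
  Neither \<open>U - F(U)\<close> nor \<open>U + F(U)\<close> need satisfy the half-space inequality, but it holds for both
  after a correction that is odd in \<open>\<kappa>\<close> and depends on \<open>U\<close> only through the first component of the
  magnetic field. Where that component is the same on both sides, the corrections cancel.
\<close>

lemma lax_friedrichs_splitting_pos:
  assumes \<Gamma>: "1 < \<Gamma>" "\<Gamma> \<le> 2" and \<kappa>: "\<kappa>\<^sup>2 = 1" and U: "U \<in> admissible \<Gamma>" and w: "norm w < 1"
  shows "0 < (U - \<kappa> *\<^sub>R flux1 \<Gamma> U) \<bullet> dual_vec w C + mag_pressure w C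
    - \<kappa> * (w$1 * mag_pressure w C - magnetic U $ 1 * (w \<bullet> C))"
proof -
  obtain \<rho> v B p H m D where 
    pos: "\<rho> > 0" "p > 0" and v: "norm v < 1"
    and H: "H = (\<rho> + \<Gamma> / (\<Gamma> - 1) * p) / (1 - v \<bullet> v)"
    and D: "D = \<rho> / sqrt (1 - v \<bullet> v)" and m: "m = (H + B \<bullet> B) *\<^sub>R v - (v \<bullet> B) *\<^sub>R B"
    and Ue: "U = (D, m, B, H - p - mag_pressure v B + B \<bullet> B)"
    and F: "flux1 \<Gamma> U = (D * v$1,
       v$1 *\<^sub>R m - B$1 *\<^sub>R ((1 - v \<bullet> v) *\<^sub>R B + (v \<bullet> B) *\<^sub>R v) + (p + mag_pressure v B) *\<^sub>R axis 1 1,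
       v$1 *\<^sub>R B - B$1 *\<^sub>R v, m$1)"
    by (rule admissible_fluxE[OF \<Gamma>(1) U])
  define s t q x where "s = 1 - \<kappa> * v$1" and "t = 1 - \<kappa> * w$1" and "q = 1 - v \<bullet> w" and "x = \<kappa> * B$1"
  define Y where "Y = s *\<^sub>R B + x *\<^sub>R (v - w)"
  define P where "P = mag_pressure v B"
  have hyd: "0 < H * s * q - p * t - sqrt (1 - w \<bullet> w) * D * s"
    using hydro_part_pos[OF \<Gamma> \<kappa> v w pos H] by (simp add: D s_def t_def q_def)
  have mag: "0 \<le> (B \<bullet> B) * s * q - P * t + x * (v \<bullet> B) * q
     + (w \<bullet> B) * (s * (v \<bullet> B) - x * (1 - v \<bullet> v))
     - ((1 - w \<bullet> w) * (C \<bullet> Y) + (w \<bullet> C) * (w \<bullet> Y)) + mag_pressure w C * t"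
    using magnetic_part_nonneg[OF \<kappa> w, of B v C]
    by (simp add: mag_pressure_eq[OF v] mag_pressure_eq[OF w] P_def Y_def s_def t_def q_def x_def)
  have CY: "C \<bullet> Y = s * (C \<bullet> B) + x * (C \<bullet> v - w \<bullet> C)" and wY: "w \<bullet> Y = s * (w \<bullet> B) + x * (v \<bullet> w - w \<bullet> w)"
    unfolding Y_def by (simp_all add: inner_diff_right inner_add_right inner_commute[of w v] inner_commute[of C w])
  have ax: "w \<bullet> axis 1 1 = w$1" by (simp add: inner_axis)
  have mw: "w \<bullet> m = (H + B \<bullet> B) * (v \<bullet> w) - (v \<bullet> B) * (w \<bullet> B)"
    by (simp add: m inner_diff_right inner_commute[of w v])
  have m1: "m$1 = (H + B \<bullet> B) * v$1 - (v \<bullet> B) * B$1" by (simp add: m)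
  have mU: "magnetic U = B" by (simp add: Ue magnetic_def)
  have Un: "U \<bullet> dual_vec w C = (H - p - P + B \<bullet> B) - sqrt (1 - w \<bullet> w) * D - w \<bullet> m
      - ((1 - w \<bullet> w) * (C \<bullet> B) + (w \<bullet> C) * (w \<bullet> B))"
    unfolding Ue inner_dual_vec P_def ..
  have Fn: "flux1 \<Gamma> U \<bullet> dual_vec w C = m$1 - sqrt (1 - w \<bullet> w) * (D * v$1)
      - (v$1 * (w \<bullet> m) - B$1 * ((1 - v \<bullet> v) * (w \<bullet> B) + (v \<bullet> B) * (v \<bullet> w)) + (p + P) * w$1)
      - ((1 - w \<bullet> w) * (v$1 * (C \<bullet> B) - B$1 * (C \<bullet> v)) + (w \<bullet> C) * (v$1 * (w \<bullet> B) - B$1 * (v \<bullet> w)))"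
    unfolding F inner_dual_vec P_def
    by (simp only: inner_add_right inner_diff_right inner_scaleR_right ax inner_commute[of w v])
  show ?thesis
    using hyd mag splitting_algebra[of H p P "B \<bullet> B" "sqrt (1 - w \<bullet> w)" D "v \<bullet> w" "v \<bullet> B" "w \<bullet> B" "w \<bullet> w" "C \<bullet> B"
       "w \<bullet> C" \<kappa> "v$1" "B$1" "v \<bullet> v" "w$1" "C \<bullet> v" "mag_pressure w C"]
    unfolding inner_diff_left inner_scaleR_left Un Fn CY wY mw m1 s_def t_def q_def x_def mU
    by linarith
qed

lemma admissible_imp_dual_pos:
  assumes \<Gamma>: "1 < \<Gamma>" "\<Gamma> \<le> 2" and U: "U \<in> admissible \<Gamma>" and w: "norm w < 1"
  shows "0 < U \<bullet> dual_vec w C + mag_pressure w C"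
  using lax_friedrichs_splitting_pos[OF \<Gamma> _ U w, of 1 C] lax_friedrichs_splitting_pos[OF \<Gamma> _ U w, of "-1" C]
  by (simp add: inner_diff_left inner_add_left)

lemma density_splitting_pos:
  assumes \<Gamma>: "1 < \<Gamma>" and \<kappa>: "\<kappa>\<^sup>2 = 1" and U: "U \<in> admissible \<Gamma>"
  shows "0 < (U - \<kappa> *\<^sub>R flux1 \<Gamma> U) \<bullet> (1, 0, 0, 0)"
proof -
  obtain \<rho> v B p H m D where 
    pos: "\<rho> > 0" "p > 0" and v: "norm v < 1"
    and H: "H = (\<rho> + \<Gamma> / (\<Gamma> - 1) * p) / (1 - v \<bullet> v)"
    and D: "D = \<rho> / sqrt (1 - v \<bullet> v)" and m: "m = (H + B \<bullet> B) *\<^sub>R v - (v \<bullet> B) *\<^sub>R B"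
    and Ue: "U = (D, m, B, H - p - mag_pressure v B + B \<bullet> B)"
    and F: "flux1 \<Gamma> U = (D * v$1,
       v$1 *\<^sub>R m - B$1 *\<^sub>R ((1 - v \<bullet> v) *\<^sub>R B + (v \<bullet> B) *\<^sub>R v) + (p + mag_pressure v B) *\<^sub>R axis 1 1,
       v$1 *\<^sub>R B - B$1 *\<^sub>R v, m$1)"
    by (rule admissible_fluxE[OF \<Gamma>(1) U])
  have "\<bar>\<kappa>\<bar> = 1" using \<kappa> by (simp add: abs_square_eq_1)
  then have "\<bar>\<kappa> * v$1\<bar> < 1" using component_le_norm_cart[of v 1] v by (simp add: abs_mult)
  moreover have "D > 0" using D pos inner_self_less_one[OF v] by simp
  ultimately have "0 < D * (1 - \<kappa> * v$1)" by simp
  then show ?thesis unfolding F unfolding Ue by (simp add: algebra_simps)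
qed

section \<open>Recovery of the primitive variables\<close>

text \<open>
  The primitive variables are recovered from one unknown \<open>s = \<rho> h W\<^sup>2\<close>. The momentum equation is linear
  in the velocity and solved by \<open>vel s\<close>; the density follows from \<open>D\<close>, the pressure \<open>p s\<close> from the
  definition of \<open>s\<close>, and there remains the scalar equation \<open>energy s = E\<close>. At the \<open>s0\<close> where the
  pressure vanishes, \<open>energy s0 < E\<close> is exactly the half-space inequality for \<open>w = vel s0\<close> and
  \<open>C = B\<close>. As \<open>energy\<close> grows at least like \<open>s / \<Gamma>\<close>, a solution \<open>s > s0\<close> exists, and since the
  speed does not increase with \<open>s\<close>, the new state is subluminal and its pressure positive.
\<close>

lemma dual_pos_imp_admissible:
  assumes \<Gamma>: "1 < \<Gamma>" and D: "D > 0"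
    and dual: "\<And>w. norm w < 1 \<Longrightarrow> 0 < (D, m, B, E) \<bullet> dual_vec w B + mag_pressure w B"
  shows "(D, m, B, E) \<in> admissible \<Gamma>"
proof -
  define \<beta> where "\<beta> = B \<bullet> B"
  define vel where "vel s = (1 / (s + \<beta>)) *\<^sub>R (m + ((m \<bullet> B) / s) *\<^sub>R B)" for s
  define V where "V s = vel s \<bullet> vel s" for s
  define p where "p s = (\<Gamma> - 1) / \<Gamma> * (s * (1 - V s) - D * sqrt (1 - V s))" for s
  define mag where "mag s = ((1 - V s) * \<beta> + (vel s \<bullet> B)\<^sup>2) / 2" for s
  have \<beta>: "\<beta> \<ge> 0" by (simp add: \<beta>_def)
  have velB: "vel s \<bullet> B = (m \<bullet> B) / s" if "s > 0" for s
  proof -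
    have "vel s \<bullet> B = (1 / (s + \<beta>)) * (m \<bullet> B + (m \<bullet> B) / s * \<beta>)"
      by (simp add: vel_def inner_add_left \<beta>_def)
    also have "\<dots> = (1 / (s + \<beta>)) * ((m \<bullet> B) * (s + \<beta>) / s)"
      using that by (simp add: field_simps)
    finally show ?thesis using that \<beta> by simp
  qed
  have mom: "(s + \<beta>) *\<^sub>R vel s - (vel s \<bullet> B) *\<^sub>R B = m" if "s > 0" for s
    using that \<beta> unfolding velB[OF that] by (simp add: vel_def)
  have Veq: "V s = (m \<bullet> m + 2 * (m \<bullet> B)\<^sup>2 / s + (m \<bullet> B)\<^sup>2 * \<beta> / s\<^sup>2) / (s + \<beta>)\<^sup>2" if "s > 0" for s
  proof -
    have "V s = (1 / (s + \<beta>)) * ((1 / (s + \<beta>)) *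
        ((m + ((m \<bullet> B) / s) *\<^sub>R B) \<bullet> (m + ((m \<bullet> B) / s) *\<^sub>R B)))"
      unfolding V_def vel_def by (simp only: inner_scaleR_left inner_scaleR_right)
    also have "(m + ((m \<bullet> B) / s) *\<^sub>R B) \<bullet> (m + ((m \<bullet> B) / s) *\<^sub>R B)
        = m \<bullet> m + 2 * (m \<bullet> B)\<^sup>2 / s + (m \<bullet> B)\<^sup>2 * \<beta> / s\<^sup>2"
      by (simp add: inner_add_left inner_add_right inner_commute[of B m] \<beta>_def power2_eq_square
          distrib_left add_divide_distrib)
    finally show ?thesis by (simp add: power2_eq_square)
  qed
  have V_mono: "V s' \<le> V s" if "0 < s" "s \<le> s'" for s s'
  proof -
    have "0 < s'" using that by simp
    show ?thesis
      unfolding Veq[OF \<open>0 < s\<close>] Veq[OF \<open>0 < s'\<close>] using that \<beta>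
      by (intro frac_le add_mono divide_left_mono power_mono add_nonneg_nonneg mult_nonneg_nonneg divide_nonneg_nonneg) auto
  qed
  have V_nonneg: "V s \<ge> 0" for s by (simp add: V_def)
  have cont_vel: "continuous_on {a..b} vel" if "0 < a" for a b
    unfolding vel_def using that \<beta> by (intro continuous_intros) auto
  have cont_V: "continuous_on {a..b} V" if "0 < a" for a b
    unfolding V_def by (intro continuous_intros cont_vel that)

  \<comment> \<open>The state of zero pressure: \<open>p s = 0\<close> if \<open>s sqrt (1 - V s) = D\<close>.\<close>
  obtain s0 where s0: "D \<le> s0" "s0\<^sup>2 * (1 - V s0) = D\<^sup>2"
  proof -
    \<comment> \<open>\<open>K\<close> bounds \<open>s\<^sup>2 * V s\<close> for \<open>s \<ge> 1\<close>.\<close>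
    define K where "K = m \<bullet> m + 2 * (m \<bullet> B)\<^sup>2 + (m \<bullet> B)\<^sup>2 * \<beta>"
    define S where "S = 1 + D + D\<^sup>2 + K"
    have K: "K \<ge> 0" using \<beta> by (simp add: K_def)
    have S: "S \<ge> 1" "S \<ge> D" "S \<ge> D\<^sup>2 + K" using K D by (auto simp: S_def)
    have "V S \<le> K / S\<^sup>2"
    proof -
      have S0: "S > 0" "1 \<le> S\<^sup>2" using S by auto
      have shrink: "a / y \<le> a" if "0 \<le> a" "1 \<le> y" for a y :: real
        using mult_left_mono[of 1 y a] that by (simp add: divide_le_eq)
      have "m \<bullet> m + 2 * (m \<bullet> B)\<^sup>2 / S + (m \<bullet> B)\<^sup>2 * \<beta> / S\<^sup>2 \<le> K"
        unfolding K_def using S(1) S0(2) \<beta> by (intro add_mono shrink) auto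
      moreover have "S\<^sup>2 \<le> (S + \<beta>)\<^sup>2" using S0 \<beta> by (intro power_mono) auto
      ultimately show ?thesis unfolding Veq[OF S0(1)] using K S0 by (intro frac_le) auto
    qed
    then have "S\<^sup>2 * V S \<le> K" using S by (simp add: field_simps)
    moreover have "S \<le> S\<^sup>2" using S by (simp add: power2_eq_square)
    ultimately have "D\<^sup>2 \<le> S\<^sup>2 * (1 - V S)" using S by (simp add: right_diff_distrib)
    moreover have "D\<^sup>2 * (1 - V D) \<le> D\<^sup>2" using V_nonneg by (simp add: mult_left_le)
    moreover have "continuous_on {D..S} (\<lambda>s. s\<^sup>2 * (1 - V s))"
      by (intro continuous_intros cont_V D)
    ultimately have "\<exists>s. D \<le> s \<and> s \<le> S \<and> s\<^sup>2 * (1 - V s) = D\<^sup>2"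
      using S by (intro IVT') auto
    then show ?thesis using that by blast
  qed
  have s0_pos: "s0 > 0" using s0 D by simp
  have V0: "V s0 < 1"
  proof -
    have "0 < s0\<^sup>2 * (1 - V s0)" using s0 D by simp
    then show ?thesis by (simp add: zero_less_mult_iff)
  qed
  have norm_vel: "norm (vel s) < 1" if "V s < 1" for s
    using that by (simp add: V_def norm_eq_sqrt_inner)
  have sD: "s0 * sqrt (1 - V s0) = D"
  proof -
    have "sqrt (s0\<^sup>2 * (1 - V s0)) = D" unfolding s0 using D by simp
    then show ?thesis using s0_pos by (simp add: real_sqrt_mult)
  qed
  have sq: "sqrt (1 - V s) * sqrt (1 - V s) = 1 - V s" if "V s < 1" for s
    using that by simp

  define energy where "energy s = s - p s - mag s + \<beta>" for s
  have p0: "p s0 = 0"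
  proof -
    have "D * sqrt (1 - V s0) = s0 * (1 - V s0)"
      unfolding sD[symmetric] using sq[OF V0] by (simp add: mult.assoc)
    then show ?thesis by (simp add: p_def)
  qed
  have low: "energy s0 < E"
  proof -
    have m0: "vel s0 \<bullet> m = (s0 + \<beta>) * V s0 - (vel s0 \<bullet> B)\<^sup>2"
      by (subst mom[OF s0_pos, symmetric]) (simp add: inner_diff_right V_def power2_eq_square)
    have "sqrt (1 - V s0) * D = s0 * (1 - V s0)"
      unfolding sD[symmetric] using sq[OF V0] by (simp add: mult.left_commute)
    then have "E - s0 * (1 - V s0) - vel s0 \<bullet> m - ((1 - V s0) * \<beta> + (vel s0 \<bullet> B) * (vel s0 \<bullet> B))
         + ((1 - V s0) * \<beta> + (vel s0 \<bullet> B)\<^sup>2) / 2 > 0"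
      using dual[OF norm_vel[OF V0]] unfolding inner_dual_vec mag_pressure_eq[OF norm_vel[OF V0]]
      by (simp add: V_def \<beta>_def)
    then show ?thesis unfolding energy_def p0 mag_def m0 by (simp add: power2_eq_square field_simps)
  qed

  \<comment> \<open>From \<open>energy S \<ge> S / \<Gamma>\<close>, this \<open>S\<close> is large enough for the intermediate value theorem.\<close>
  define S where "S = max s0 (\<Gamma> * E)"
  have S: "s0 \<le> S" "S > 0" "E \<le> S / \<Gamma>" using s0_pos \<Gamma> by (auto simp: S_def field_simps)
  have VS: "V S < 1" using V_mono[OF s0_pos S(1)] V0 by simp
  have high: "E \<le> energy S"
  proof -
    have "S * (1 - V S) - D * sqrt (1 - V S) \<le> S"
    proof -
      have "S * (1 - V S) \<le> S" using V_nonneg S by (simp add: mult_left_le)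
      moreover have "0 \<le> D * sqrt (1 - V S)" using VS D by simp
      ultimately show ?thesis by linarith
    qed
    then have "p S \<le> (\<Gamma> - 1) / \<Gamma> * S" unfolding p_def using \<Gamma> by (intro mult_left_mono) auto
    also have "\<dots> = S - S / \<Gamma>" using \<Gamma> by (simp add: field_simps)
    finally have "p S \<le> S - S / \<Gamma>" .
    moreover have "mag S \<le> \<beta>"
    proof -
      have "(vel S \<bullet> B)\<^sup>2 \<le> V S * \<beta>" unfolding V_def \<beta>_def by (rule Cauchy_Schwarz_ineq)
      then show ?thesis unfolding mag_def using \<beta> by (simp add: algebra_simps)
    qed
    ultimately show ?thesis using S by (simp add: energy_def)
  qed
  have "continuous_on {s0..S} energy"
    unfolding energy_def p_def mag_def
    by (intro continuous_intros cont_V cont_vel s0_pos) auto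
  then obtain s where s: "s0 \<le> s" "s \<le> S" "energy s = E"
    using IVT'[of energy s0 E S] low high S(1) by auto
  have "s \<noteq> s0" using s low by auto
  then have gt: "s0 < s" and s_pos: "s > 0" using s s0_pos by auto
  have Vs: "V s \<le> V s0" using V_mono[OF s0_pos s(1)] .
  then have Vs1: "V s < 1" using V0 by simp
  have p_pos: "p s > 0"
  proof -
    have "D < s * sqrt (1 - V s0)" unfolding sD[symmetric] using gt V0 by simp
    also have "\<dots> \<le> s * sqrt (1 - V s)" using Vs s_pos by simp
    finally have "D * sqrt (1 - V s) < s * sqrt (1 - V s) * sqrt (1 - V s)"
      using Vs1 by (intro mult_strict_right_mono) auto
    then have "0 < s * (1 - V s) - D * sqrt (1 - V s)"
      using sq[OF Vs1] by (simp add: mult.assoc)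
    then show ?thesis unfolding p_def using \<Gamma> by simp
  qed
  define \<rho> where "\<rho> = D * sqrt (1 - V s)"
  have \<rho>: "\<rho> > 0" using D Vs1 by (simp add: \<rho>_def)
  have "\<Gamma> / (\<Gamma> - 1) * p s = s * (1 - V s) - \<rho>"
    unfolding p_def \<rho>_def using \<Gamma> by simp
  then have H: "s = (\<rho> + \<Gamma> / (\<Gamma> - 1) * p s) / (1 - vel s \<bullet> vel s)"
    using Vs1 by (simp add: V_def)
  have "cons_of_prim \<Gamma> (\<rho>, vel s, B, p s) = (D, m, B, E)"
    unfolding cons_of_prim_eq[OF \<Gamma> \<rho> norm_vel[OF Vs1] H] \<beta>_def[symmetric] mom[OF s_pos]
      mag_pressure_eq[OF norm_vel[OF Vs1]]
    using s(3) Vs1 by (simp add: energy_def mag_def \<rho>_def V_def)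
  moreover have "(\<rho>, vel s, B, p s) \<in> prim_states"
    using \<rho> p_pos norm_vel[OF Vs1] by (simp add: prim_states_def)
  ultimately show ?thesis unfolding admissible_def by (metis image_eqI)
qed

section \<open>Positivity of the updated average\<close>

text \<open>
  An affine functional that is positive at the nodes stays positive under the update if the flux
  has a partner \<open>d\<close>: at both interfaces the four traces contribute positive terms
  \<open>(V \<mp> F V) \<bullet> n + c \<mp> d\<close>, in whose sum \<open>d\<close> cancels. What the numerical fluxes take from the cell
  itself is \<open>\<mu>\<close> times its two end values, and the end weights pay for it.
\<close>

lemma lax_friedrichs_update_pos:
  fixes n Y Z :: "'a::real_inner" and X :: "nat \<Rightarrow> 'a"
  assumes L: "L \<ge> 2" and \<omega>: "(\<Sum>\<alpha>\<in>{1..L}. \<omega> \<alpha>) = 1" "\<omega> L = \<omega> 1" "\<And>\<alpha>. \<alpha> \<in> {1<..<L} \<Longrightarrow> 0 \<le> \<omega> \<alpha>"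
    and \<mu>: "0 < \<mu>" "\<mu> \<le> \<omega> 1"
    and pos: "\<And>\<alpha>. \<alpha> \<in> {1..L} \<Longrightarrow> 0 < X \<alpha> \<bullet> n + c"
    and right: "\<And>V. V \<in> {X L, Z} \<Longrightarrow> 0 < (V - F V) \<bullet> n + c - d"
    and left: "\<And>V. V \<in> {X 1, Y} \<Longrightarrow> 0 < (V + F V) \<bullet> n + c + d"
  shows "0 < ((\<Sum>\<alpha>\<in>{1..L}. \<omega> \<alpha> *\<^sub>R X \<alpha>)
     - \<mu> *\<^sub>R ((1/2) *\<^sub>R (F (X L) + F Z - (Z - X L)) - (1/2) *\<^sub>R (F Y + F (X 1) - (X 1 - Y)))) \<bullet> n + c"
proof -
  let ?a = "\<lambda>\<alpha>. X \<alpha> \<bullet> n + c"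
  let ?S = "((X L - F (X L)) \<bullet> n + c - d) + ((Z - F Z) \<bullet> n + c - d)
     + ((X 1 + F (X 1)) \<bullet> n + c + d) + ((Y + F Y) \<bullet> n + c + d)"
  have "(\<Sum>\<alpha>\<in>{1..L}. \<omega> \<alpha> *\<^sub>R X \<alpha>) \<bullet> n + c = (\<Sum>\<alpha>\<in>{1..L}. \<omega> \<alpha> * (X \<alpha> \<bullet> n)) + (\<Sum>\<alpha>\<in>{1..L}. \<omega> \<alpha>) * c"
    unfolding \<omega>(1) by (simp add: inner_sum_left)
  also have "\<dots> = (\<Sum>\<alpha>\<in>{1..L}. \<omega> \<alpha> * ?a \<alpha>)"
    by (simp add: sum_distrib_right sum.distrib distrib_left)
  finally have mean: "(\<Sum>\<alpha>\<in>{1..L}. \<omega> \<alpha> *\<^sub>R X \<alpha>) \<bullet> n + c = (\<Sum>\<alpha>\<in>{1..L}. \<omega> \<alpha> * ?a \<alpha>)" .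
  have "{1..L} - {1, L} = {1<..<L}" by auto
  then have "(\<Sum>\<alpha>\<in>{1..L}. \<omega> \<alpha> * ?a \<alpha>) = (\<Sum>\<alpha>\<in>{1<..<L}. \<omega> \<alpha> * ?a \<alpha>) + (\<Sum>\<alpha>\<in>{1, L}. \<omega> \<alpha> * ?a \<alpha>)"
    using sum.subset_diff[of "{1, L}" "{1..L}" "\<lambda>\<alpha>. \<omega> \<alpha> * ?a \<alpha>"] L by simp
  also have "(\<Sum>\<alpha>\<in>{1, L}. \<omega> \<alpha> * ?a \<alpha>) = \<omega> 1 * (?a 1 + ?a L)"
    using L by (simp add: \<omega>(2) distrib_left)
  also have "0 \<le> (\<Sum>\<alpha>\<in>{1<..<L}. \<omega> \<alpha> * ?a \<alpha>)"
    using \<omega>(3) pos by (intro sum_nonneg mult_nonneg_nonneg) (auto simp: less_imp_le)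
  moreover have "\<mu> * (?a 1 + ?a L) \<le> \<omega> 1 * (?a 1 + ?a L)"
    using pos[of 1] pos[of L] L \<mu> by (intro mult_right_mono) auto
  ultimately have "\<mu> * (?a 1 + ?a L) \<le> (\<Sum>\<alpha>\<in>{1..L}. \<omega> \<alpha> *\<^sub>R X \<alpha>) \<bullet> n + c"
    unfolding mean by linarith
  moreover have "0 < \<mu> / 2 * ?S"
    using right[of "X L"] right[of Z] left[of "X 1"] left[of Y] \<mu> by (intro mult_pos_pos) auto
  moreover have "\<mu> / 2 * ?S - \<mu> * (?a 1 + ?a L) =
     - (\<mu> *\<^sub>R ((1/2) *\<^sub>R (F (X L) + F Z - (Z - X L)) - (1/2) *\<^sub>R (F Y + F (X 1) - (X 1 - Y)))) \<bullet> n"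
    by (simp add: inner_diff_left inner_add_left) (simp add: field_simps)
  ultimately show ?thesis by (simp only: inner_diff_left inner_minus_left)
qed

lemma vec_poly_continuous:
  fixes f :: "real \<Rightarrow> 'a::real_normed_vector"
  assumes "vec_poly K f"
  shows "continuous_on S f"
proof -
  obtain C where "f = (\<lambda>x. \<Sum>k\<le>K. x ^ k *\<^sub>R C k)" using assms by (auto simp: vec_poly_def)
  then show ?thesis by (auto intro!: continuous_intros)
qed

theorem theorem3p2:
  fixes \<Gamma> \<Delta>x \<Delta>t Bconst :: real
    and K L :: nat
    and xh :: "int \<Rightarrow> real"
    and \<xi> :: "nat \<Rightarrow> real"
    and U :: "int \<Rightarrow> real \<Rightarrow> cons"
    and Uavg Uavg_next :: "int \<Rightarrow> cons"
  assumes "1 < \<Gamma>" and "\<Gamma> \<le> 2"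
    and "\<Delta>x > 0" and "\<And>j. xh j - xh (j - 1) = \<Delta>x"
    and "K \<ge> 1" and "2 * L \<ge> K + 3"
    and "gauss_lobatto_nodes L \<xi>"
    and "\<And>j. vec_poly K (U j)"
    and "\<And>j. Uavg j = (1 / \<Delta>x) *\<^sub>R integral (cell xh j) (U j)"
    and scheme: "\<And>j. Uavg_next j = Uavg j - (\<Delta>t / \<Delta>x) *\<^sub>R
           (num_flux1 \<Gamma> (U j (xh j)) (U (j + 1) (xh j))
            - num_flux1 \<Gamma> (U (j - 1) (xh (j - 1))) (U j (xh (j - 1))))"
    and "\<And>j x. x \<in> cell xh j \<Longrightarrow> magnetic (U j x) $ 1 = Bconst"
    and "\<And>j \<alpha>. \<alpha> \<in> {1..L} \<Longrightarrow> U j (cell_node xh \<xi> j \<alpha>) \<in> admissible \<Gamma>"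
    and "0 < \<Delta>t" and "\<Delta>t \<le> quad_weight L \<xi> 1 * \<Delta>x"
  shows "\<forall>j. Uavg_next j \<in> admissible \<Gamma>"
proof
  fix j
  note \<Gamma> = assms(1,2) and dx = assms(3,4) and KL = assms(6) and nodes = assms(7)
    and poly = assms(8) and avg = assms(9) and Bc = assms(11) and adm = assms(12) and dt = assms(13,14)
  note nd = lobatto_nodesD[OF nodes]
  define \<mu> where "\<mu> = \<Delta>t / \<Delta>x"
  have \<mu>: "0 < \<mu>" "\<mu> \<le> quad_weight L \<xi> 1"
    using dt dx(1) by (simp_all add: \<mu>_def field_simps)
  have ends: "cell_node xh \<xi> i 1 = xh (i - 1)" "cell_node xh \<xi> i L = xh i" for i
    using nd(3,4) by (simp_all add: cell_node_def field_simps)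
  \<comment> \<open>The polynomials are continuous, so \<open>B\<^sub>1\<close> is constant up to the cell interfaces.\<close>
  have B1: "magnetic (U i x) $ 1 = Bconst" if "x \<in> {xh (i - 1)..xh i}" for i x
  proof -
    have cl: "closure (cell xh i) = {xh (i - 1)..xh i}"
      using dx(1) dx(2)[of i] by (simp add: cell_def)
    have "continuous_on (closure (cell xh i)) (\<lambda>x. fst (snd (snd (U i x))) $ 1)"
      by (intro continuous_intros vec_poly_continuous[OF poly])
    then have "continuous_on (closure (cell xh i)) (\<lambda>x. magnetic (U i x) $ 1)"
      by (simp add: magnetic_def case_prod_beta)
    then show ?thesis
      by (rule continuous_constant_on_closure) (use Bc that cl in auto)
  qed
  define traces where "traces = {U j (xh j), U (j + 1) (xh j), U (j - 1) (xh (j - 1)), U j (xh (j - 1))}"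
  have tr: "V \<in> admissible \<Gamma>" "magnetic V $ 1 = Bconst" if "V \<in> traces" for V
  proof -
    have le: "xh (i - 1) \<le> xh i" for i using dx(1) dx(2)[of i] by simp
    have r: "U i (xh i) \<in> admissible \<Gamma>" "magnetic (U i (xh i)) $ 1 = Bconst" for i
      using adm[of L i, unfolded ends] B1[of "xh i" i] le[of i] nd(1) by auto
    have l: "U i (xh (i - 1)) \<in> admissible \<Gamma>" "magnetic (U i (xh (i - 1))) $ 1 = Bconst" for i
      using adm[of 1 i, unfolded ends] B1[of "xh (i - 1)" i] le[of i] nd(1) by auto
    show "V \<in> admissible \<Gamma>" "magnetic V $ 1 = Bconst"
      using that r[of j] r[of "j - 1"] l[of j] l[of "j + 1"] by (auto simp: traces_def)
  qed
  have next_eq: "Uavg_next j = (\<Sum>\<alpha>\<in>{1..L}. quad_weight L \<xi> \<alpha> *\<^sub>R U j (cell_node xh \<xi> j \<alpha>))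
     - \<mu> *\<^sub>R ((1/2) *\<^sub>R (flux1 \<Gamma> (U j (cell_node xh \<xi> j L)) + flux1 \<Gamma> (U (j + 1) (xh j)) - (U (j + 1) (xh j) - U j (cell_node xh \<xi> j L)))
         - (1/2) *\<^sub>R (flux1 \<Gamma> (U (j - 1) (xh (j - 1))) + flux1 \<Gamma> (U j (cell_node xh \<xi> j 1)) - (U j (cell_node xh \<xi> j 1) - U (j - 1) (xh (j - 1)))))"
    unfolding scheme avg num_flux1_def ends \<mu>_def cell_average[OF nodes KL dx(1) dx(2)[of j] poly[of j]] ..
  have functional: "0 < Uavg_next j \<bullet> n + c"
    if split: "\<And>V \<kappa>. V \<in> traces \<Longrightarrow> \<kappa> \<in> {1, -1} \<Longrightarrow> 0 < (V - \<kappa> *\<^sub>R flux1 \<Gamma> V) \<bullet> n + c - \<kappa> * d"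
      and pos: "\<And>V. V \<in> admissible \<Gamma> \<Longrightarrow> 0 < V \<bullet> n + c" for n c d
    unfolding next_eq
  proof (rule lax_friedrichs_update_pos[where d = d])
    show "0 < (V - flux1 \<Gamma> V) \<bullet> n + c - d" if "V \<in> {U j (cell_node xh \<xi> j L), U (j + 1) (xh j)}" for V
      using that split[of V 1] unfolding ends traces_def by auto
    show "0 < (V + flux1 \<Gamma> V) \<bullet> n + c + d" if "V \<in> {U j (cell_node xh \<xi> j 1), U (j - 1) (xh (j - 1))}" for V
      using that split[of V "-1"] unfolding ends traces_def by auto
  qed (use nd(1) \<mu> lobatto_weights_sum[OF nodes] lobatto_end_weights_eq[OF nodes]
        lobatto_weight_nonneg[OF nodes] pos adm in auto)
  \<comment> \<open>The density has the partner \<open>d = 0\<close>, as \<open>D (1 \<mp> v\<^sub>1) > 0\<close>.\<close>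
  have dens: "0 < Uavg_next j \<bullet> (1, 0, 0, 0) + 0"
  proof (rule functional[where d = 0])
    show "0 < V \<bullet> (1, 0, 0, 0) + 0" if "V \<in> admissible \<Gamma>" for V
      using density_splitting_pos[OF \<Gamma>(1) _ that, of 1] density_splitting_pos[OF \<Gamma>(1) _ that, of "-1"]
      by (simp add: inner_diff_left inner_add_left)
    show "0 < (V - \<kappa> *\<^sub>R flux1 \<Gamma> V) \<bullet> (1, 0, 0, 0) + 0 - \<kappa> * 0"
      if "V \<in> traces" "\<kappa> \<in> {1, -1}" for V \<kappa>
      using density_splitting_pos[OF \<Gamma>(1) _ tr(1)[OF that(1)], of \<kappa>] that(2) by auto
  qed
  \<comment> \<open>The correction is the same for all traces, as they share the value of \<open>B\<^sub>1\<close>.\<close>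
  have dual: "0 < Uavg_next j \<bullet> dual_vec w C + mag_pressure w C" if w: "norm w < 1" for w C
  proof (rule functional[where d = "w$1 * mag_pressure w C - Bconst * (w \<bullet> C)"])
    show "0 < (V - \<kappa> *\<^sub>R flux1 \<Gamma> V) \<bullet> dual_vec w C + mag_pressure w C
        - \<kappa> * (w$1 * mag_pressure w C - Bconst * (w \<bullet> C))" if "V \<in> traces" "\<kappa> \<in> {1, -1}" for V \<kappa>
      using lax_friedrichs_splitting_pos[OF \<Gamma> _ tr(1)[OF that(1)] w, of \<kappa> C] that(2)
      unfolding tr(2)[OF that(1)] by auto
  qed (rule admissible_imp_dual_pos[OF \<Gamma> _ w])
  obtain D m B E where e: "Uavg_next j = (D, m, B, E)" by (cases "Uavg_next j") auto
  show "Uavg_next j \<in> admissible \<Gamma>"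
    using dens dual unfolding e by (intro dual_pos_imp_admissible[OF \<Gamma>(1)]) auto
qed

end
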